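(* There exist $\lambda_0>0$ and $K>0$ (with $K$ depending on $\lambda_0$) such that for all $n,N\in\mathbb{N}$ with $\lambda_0 V^{1/2}>1$ (where $V=2^N$), $$c_n^{(N)} \le K\,\mu_N(\lambda_0)^n .$$
   Context: Let $\mathbb{N}=\{1,2,\dots\}$. For $N\in\mathbb{N}$, $\mathbb{Q}^N=\mathbb{Z}_2^N$ is the $N$-dimensional hypercube (binary strings of length $N$, with coordinatewise addition mod 2), $V=V(N)=2^N$, and $|x|$ is the number of coordinates of $x\in\mathbb{Q}^N$ equal to 1. An $n$-step self-avoiding walk is a function $\omega:\{0,\dots,n\}\to\mathbb{Q}^N$ with $|\omega(i)-\omega(i-1)|=1$ for $1\le i\le n$ and $\omega(i)\ne\omega(j)$ for $i\neq j$. $c_n^{(N)}$ is the number of $n$-step self-avoiding walks with $\omega(0)=0$, with $c_0^{(N)}=1$ (so $c_n^{(N)}=0$ for $n\ge V$). The susceptibility is the polynomial $\chi_N(z)=\sum_{n=0}^{V-1}c_n^{(N)}z^n$. For $\lambda>0$ with $\lambda V^{1/2}>1$, the critical value $z_N=z_N(\lambda)>0$ is the unique positive solution of $\chi_N(z_N)=\lambda V^{1/2}$, and the connective constant is $\mu_N(\lambda)=1/z_N(\lambda)$. *)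

theory Defs
  imports Complex_Main "HOL-Library.FuncSet" "HOL-Library.Z2"
begin

definition hypercube :: "nat \<Rightarrow> bit list set" where
  "hypercube N = {x. length x = N}"

definition hc_zero :: "nat \<Rightarrow> bit list" where
  "hc_zero N = replicate N 0"

definition hc_diff :: "bit list \<Rightarrow> bit list \<Rightarrow> bit list" where
  "hc_diff x y = map2 (-) x y"

definition hc_weight :: "bit list \<Rightarrow> nat" where
  "hc_weight x = card {i. i < length x \<and> x ! i = 1}"

definition hc_volume :: "nat \<Rightarrow> nat" where
  "hc_volume N = 2 ^ N"

text \<open>The extensional function space makes a walk a function on \<open>{0..n}\<close> only, so that
  walks can be counted.\<close>

definition self_avoiding_walks :: "nat \<Rightarrow> nat \<Rightarrow> (nat \<Rightarrow> bit list) set" where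
  "self_avoiding_walks N n = {\<omega> \<in> {0..n} \<rightarrow>\<^sub>E hypercube N.
     (\<forall>i\<in>{1..n}. hc_weight (hc_diff (\<omega> i) (\<omega> (i - 1))) = 1) \<and>
     (\<forall>i\<in>{0..n}. \<forall>j\<in>{0..n}. i \<noteq> j \<longrightarrow> \<omega> i \<noteq> \<omega> j)}"

definition saw_count :: "nat \<Rightarrow> nat \<Rightarrow> nat" where
  "saw_count N n = card {\<omega> \<in> self_avoiding_walks N n. \<omega> 0 = hc_zero N}"

definition susceptibility :: "nat \<Rightarrow> real \<Rightarrow> real" where
  "susceptibility N z = (\<Sum>n = 0..hc_volume N - 1. real (saw_count N n) * z ^ n)"

text \<open>Only meaningful for \<open>N \<ge> 1\<close> and \<open>lam * sqrt V > 1\<close>; see \<open>ex1_critical_value\<close> below.\<close>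

definition critical_value :: "nat \<Rightarrow> real \<Rightarrow> real" where
  "critical_value N lam =
     (THE z. z > 0 \<and> susceptibility N z = lam * sqrt (real (hc_volume N)))"

definition connective_constant :: "nat \<Rightarrow> real \<Rightarrow> real" where
  "connective_constant N lam = 1 / critical_value N lam"

lemma finite_hypercube: "finite (hypercube N)" and card_hypercube: "card (hypercube N) = 2 ^ N"
proof -
  have U: "(UNIV :: bit set) = {0, 1}"
    by (metis (full_types) UNIV_eq_I bit_not_zero_iff insert_iff)
  have f: "finite (UNIV :: bit set)" and c: "card (UNIV :: bit set) = 2"
    unfolding U by simp_all
  have eq: "hypercube N = {xs. set xs \<subseteq> (UNIV :: bit set) \<and> length xs = N}"
    by (simp add: hypercube_def)
  show "finite (hypercube N)" unfolding eq by (rule finite_lists_length_eq[OF f])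
  show "card (hypercube N) = 2 ^ N" unfolding eq using card_lists_length_eq[OF f, of N] c by simp
qed

lemma finite_self_avoiding_walks: "finite (self_avoiding_walks N n)"
  by (rule finite_subset[of _ "{0..n} \<rightarrow>\<^sub>E hypercube N"])
    (auto simp: self_avoiding_walks_def intro!: finite_PiE finite_hypercube)

lemma saw_count_0: "saw_count N 0 = 1"
proof -
  have "{\<omega> \<in> self_avoiding_walks N 0. \<omega> 0 = hc_zero N} = {restrict (\<lambda>_. hc_zero N) {0}}"
    by (auto simp: self_avoiding_walks_def PiE_def extensional_def fun_eq_iff restrict_def
        hypercube_def hc_zero_def)
  then show ?thesis by (simp add: saw_count_def)
qed

lemma saw_count_eq_0:
  assumes "n \<ge> hc_volume N"
  shows "saw_count N n = 0"
proof -
  have "\<omega> \<notin> self_avoiding_walks N n" for \<omega>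
  proof
    assume w: "\<omega> \<in> self_avoiding_walks N n"
    have "inj_on \<omega> {0..n}" "\<omega> ` {0..n} \<subseteq> hypercube N"
      using w by (auto simp: self_avoiding_walks_def inj_on_def PiE_def Pi_def)
    then have "card {0..n} \<le> card (hypercube N)"
      by (rule card_inj_on_le[OF _ _ finite_hypercube])
    with assms show False by (simp add: card_hypercube hc_volume_def)
  qed
  then show ?thesis by (simp add: saw_count_def)
qed

lemma saw_count_1_pos:
  assumes "N \<ge> 1"
  shows "saw_count N 1 > 0"
proof -
  define e :: "bit list" where "e = (hc_zero N)[0 := 1]"
  define \<omega> where "\<omega> = restrict (\<lambda>i::nat. if i = 0 then hc_zero N else e) {0..1}"
  have [simp]: "length e = N" "length (hc_zero N) = N" by (simp_all add: e_def hc_zero_def)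
  have nth: "e ! i = (if i = 0 then 1 else 0)" "hc_zero N ! i = 0" if "i < N" for i
    using that assms by (auto simp: e_def hc_zero_def nth_list_update)
  have "{i. i < length (hc_diff e (hc_zero N)) \<and> hc_diff e (hc_zero N) ! i = 1} = {0}"
    using assms by (auto simp: hc_diff_def nth split: if_splits)
  then have wt: "hc_weight (hc_diff e (hc_zero N)) = 1" by (simp add: hc_weight_def)
  have ne: "e \<noteq> hc_zero N" using nth[of 0] assms by fastforce
  have iv: "{1..1::nat} = {1}" "{0..1::nat} = {0, 1}" by auto
  have "\<omega> \<in> self_avoiding_walks N 1"
    using wt ne ne[symmetric] unfolding self_avoiding_walks_def iv
    by (auto simp: \<omega>_def iv hypercube_def split: if_splits)
  moreover have "\<omega> 0 = hc_zero N" by (simp add: \<omega>_def)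
  ultimately have "\<omega> \<in> {\<omega> \<in> self_avoiding_walks N 1. \<omega> 0 = hc_zero N}" by simp
  then show ?thesis
    unfolding saw_count_def using finite_self_avoiding_walks[of N 1] card_gt_0_iff by fastforce
qed

lemma ex1_critical_value:
  assumes N: "N \<ge> 1" and l: "lam * sqrt (real (hc_volume N)) > 1"
  shows "\<exists>!z. z > 0 \<and> susceptibility N z = lam * sqrt (real (hc_volume N))"
proof -
  define L where "L = lam * sqrt (real (hc_volume N))"
  let ?t = "\<lambda>z n. real (saw_count N n) * z ^ n"
  have V: "1 \<in> {0..hc_volume N - 1}"
    using power_increasing[of 1 N "2::nat"] N by (simp add: hc_volume_def)
  have mono: "susceptibility N a < susceptibility N b" if "0 \<le> a" "a < b" for a b
    unfolding susceptibility_def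
  proof (rule sum_strict_mono_ex1)
    show "\<forall>n\<in>{0..hc_volume N - 1}. ?t a n \<le> ?t b n"
      using that by (auto intro!: mult_left_mono power_mono)
    show "\<exists>n\<in>{0..hc_volume N - 1}. ?t a n < ?t b n"
      using V that saw_count_1_pos[OF N] by (intro bexI[of _ 1]) auto
  qed simp
  have at0: "susceptibility N 0 = 1"
  proof -
    have "susceptibility N 0 = (\<Sum>n = 0..hc_volume N - 1. if n = 0 then 1 else 0)"
      unfolding susceptibility_def by (rule sum.cong) (auto simp: saw_count_0)
    then show ?thesis by simp
  qed
  have atL: "L \<le> susceptibility N L"
  proof -
    have "L \<le> ?t L 1"
      using mult_right_mono[of 1 "real (saw_count N 1)" L] saw_count_1_pos[OF N] l
      by (simp add: L_def)
    also have "\<dots> \<le> susceptibility N L"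
      unfolding susceptibility_def
    proof (rule member_le_sum)
      show "0 \<le> ?t L n" for n using l by (simp add: L_def[symmetric])
    qed (use V in auto)
    finally show ?thesis .
  qed
  have "\<exists>z\<ge>0. z \<le> L \<and> susceptibility N z = L"
  proof (rule IVT')
    show "continuous_on {0..L} (susceptibility N)"
      unfolding susceptibility_def by (intro continuous_intros)
  qed (use l at0 atL in \<open>simp_all add: L_def[symmetric]\<close>)
  then obtain z where z: "z \<ge> 0" "susceptibility N z = L" by blast
  moreover have "z \<noteq> 0" using z(2) at0 l by (auto simp: L_def)
  ultimately have "z > 0 \<and> susceptibility N z = L" by simp
  moreover have "y = z" if "y > 0 \<and> susceptibility N y = L" for y
    using that z mono[of y z] mono[of z y] by (cases y z rule: linorder_cases) auto
  ultimately show ?thesis unfolding L_def[symmetric] by blast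
qed

end

theory Submission
  imports Defs "HOL-Analysis.Convex" "HOL-Library.Function_Algebras"
begin

text \<open>Let \<open>G(x)\<close> be the two-point function at \<open>z = z\<^sub>N\<close>, \<open>\<chi> = \<Sum>x. G(x)\<close>, \<open>b = (\<Sum>x\<noteq>0. G(x)\<^sup>2)\<close> and
  \<open>u n = c n * z ^ n\<close>. Among the pairs of \<open>m\<close>-step walks from \<open>0\<close>, those which meet again have
  weight at most \<open>b * M\<^sup>2\<close> with \<open>M = Max u\<close>, and the others concatenate to a \<open>2 * m\<close>-step walk. Hence
  \<open>M\<^sup>2 \<le> M + b * M\<^sup>2\<close>, that is \<open>M \<le> 1 / (1 - b)\<close>, and it suffices that \<open>b \<le> 1 / 2\<close> uniformly in \<open>N\<close>.

  No lace expansion is needed for that, only one inclusion-exclusion step: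
  \<open>G = \<delta> + z * D G - p * G + E\<close>, where \<open>D\<close> sums over the neighbours, \<open>p\<close> is the weight of
  closed walks, and \<open>0 \<le> E \<le> \<Theta> \<star> G\<close> with \<open>\<Theta>\<close> made of three walks with common endpoints.
  The spectral gap of \<open>D / N\<close> is \<open>2 / N\<close> while \<open>\<Sum>\<Theta>\<close> is of order \<open>(b + 1 / N) / N\<close>, so the
  \<open>l\<^sup>2\<close> norm of \<open>E\<close> is harmless away from the constant mode, and the constant mode contributes
  \<open>\<chi>\<^sup>2 / V = \<lambda>\<^sup>2\<close>. This improves \<open>b \<le> \<beta>\<close> to \<open>b \<le> \<beta> / 2\<close> for small \<open>\<lambda>\<close> and large \<open>N\<close>; by
  continuity in \<open>z\<close>, \<open>b \<le> \<beta>\<close> all the way from \<open>0\<close> to \<open>z\<^sub>N\<close>. Choosing \<open>\<lambda>\<close> small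
  also forces \<open>N\<close> to be large, as \<open>\<lambda> * sqrt V > 1\<close>.\<close>

section \<open>Self-avoiding walks on Cayley graphs\<close>

text \<open>The group is a finite subset of a type, so that a single type can carry the cubes of all
  dimensions. Symmetry of \<open>S\<close> is what allows walks to be reversed.\<close>

locale cayley =
  fixes Q S :: "'a::ab_group_add set"
  assumes finite_Q: "finite Q" and zero_Q: "0 \<in> Q"
    and diff_Q: "x \<in> Q \<Longrightarrow> y \<in> Q \<Longrightarrow> x - y \<in> Q"
    and S_Q: "S \<subseteq> Q" and zero_S: "0 \<notin> S"
    and uminus_S: "s \<in> S \<Longrightarrow> - s \<in> S"
begin

lemma uminus_Q: "x \<in> Q \<Longrightarrow> - x \<in> Q"
  using diff_Q[OF zero_Q, of x] by simp

lemma add_Q: "x \<in> Q \<Longrightarrow> y \<in> Q \<Longrightarrow> x + y \<in> Q"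
  using diff_Q[of x "- y"] uminus_Q by simp

lemma finite_S: "finite S"
  using finite_Q S_Q by (rule finite_subset[rotated])

lemma bij_betw_diff_Q:
  assumes "x \<in> Q"
  shows "bij_betw (\<lambda>y. y - x) Q Q" "bij_betw (\<lambda>y. x - y) Q Q"
  by (rule bij_betwI[of _ _ _ "\<lambda>y. y + x"]; use assms diff_Q add_Q in auto)
     (rule bij_betwI[of _ _ _ "\<lambda>y. x - y"]; use assms diff_Q in auto)

lemma sum_shift_Q: "x \<in> Q \<Longrightarrow> (\<Sum>y\<in>Q. f (y - x)) = (\<Sum>y\<in>Q. f y)"
  by (rule sum.reindex_bij_betw[OF bij_betw_diff_Q(1)])

lemma sum_reflect_Q: "x \<in> Q \<Longrightarrow> (\<Sum>y\<in>Q. f (x - y)) = (\<Sum>y\<in>Q. f y)"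
  by (rule sum.reindex_bij_betw[OF bij_betw_diff_Q(2)])

section \<open>Walks as vertex lists and their generating functions\<close>

definition saw :: "'a list \<Rightarrow> bool" where
  "saw p \<longleftrightarrow> p \<noteq> [] \<and> distinct p \<and> set p \<subseteq> Q \<and> successively (\<lambda>a b. b - a \<in> S) p"

definition paths :: "'a \<Rightarrow> 'a \<Rightarrow> 'a list set" where
  "paths x y = {p. saw p \<and> hd p = x \<and> last p = y}"

definition paths_of_length :: "nat \<Rightarrow> 'a \<Rightarrow> 'a list set" where
  "paths_of_length n x = {p. saw p \<and> hd p = x \<and> length p = Suc n}"

text \<open>A list of \<open>n + 1\<close> vertices is an \<open>n\<close>-step walk, hence the
  subtraction; walks are non-empty, so it never truncates on them.\<close>

definition wt :: "real \<Rightarrow> 'a list \<Rightarrow> real" where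
  "wt z p = z ^ (length p - 1)"

definition green :: "real \<Rightarrow> 'a \<Rightarrow> 'a \<Rightarrow> real" where
  "green z x y = (\<Sum>p\<in>paths x y. wt z p)"

definition two_point :: "real \<Rightarrow> 'a \<Rightarrow> real" where
  "two_point z x = green z 0 x"

lemma wt_nonneg: "z \<ge> 0 \<Longrightarrow> wt z p \<ge> 0"
  by (simp add: wt_def)

lemma finite_saw: "finite {p. saw p}"
  by (rule finite_subset[OF _ finite_subset_distinct[OF finite_Q]]) (auto simp: saw_def)

lemma finite_paths: "finite (paths x y)"
  by (rule finite_subset[OF _ finite_saw]) (auto simp: paths_def)

lemma finite_paths_of_length: "finite (paths_of_length n x)"
  by (rule finite_subset[OF _ finite_saw]) (auto simp: paths_of_length_def)

lemma green_nonneg: "z \<ge> 0 \<Longrightarrow> green z x y \<ge> 0"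
  unfolding green_def by (intro sum_nonneg wt_nonneg)

lemma two_point_nonneg: "z \<ge> 0 \<Longrightarrow> two_point z x \<ge> 0"
  unfolding two_point_def by (rule green_nonneg)

lemma saw_map_add:
  assumes "saw p" "a \<in> Q"
  shows "saw (map (\<lambda>v. v + a) p)"
  using assms by (auto simp: saw_def distinct_map inj_on_def successively_map intro: add_Q)

lemma saw_rev: "saw p \<Longrightarrow> saw (rev p)"
  using uminus_S unfolding saw_def
  by (auto intro!: successively_mono[where P = "\<lambda>a b. b - a \<in> S"]) (metis minus_diff_eq)

text \<open>Adjacency is local, so cutting at \<open>y\<close> loses only the mutual avoidance of
  the two pieces. Upper bounds below drop that condition; injections have to supply it.\<close>

lemma saw_append_iff:
  "saw (a @ y # b) \<longleftrightarrow> saw (a @ [y]) \<and> saw (y # b) \<and> set a \<inter> set b = {}"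
  unfolding saw_def by (cases b; cases "a = []") (auto simp: successively_append_iff)

lemma paths_map_add:
  assumes "p \<in> paths x y" "a \<in> Q"
  shows "map (\<lambda>v. v + a) p \<in> paths (x + a) (y + a)"
  using assms saw_map_add[of p a] by (auto simp: paths_def hd_map last_map saw_def)

lemma green_translate:
  assumes "a \<in> Q"
  shows "green z (x + a) (y + a) = green z x y"
  unfolding green_def
  by (rule sum.reindex_bij_witness[where i = "map (\<lambda>v. v + a)" and j = "map (\<lambda>v. v + - a)"])
    (use assms paths_map_add[of _ x y a] paths_map_add[of _ "x + a" "y + a" "- a"] uminus_Q
     in \<open>auto simp: comp_def wt_def\<close>)

lemma green_eq_two_point:
  assumes "x \<in> Q"
  shows "green z x y = two_point z (y - x)"
  using green_translate[OF assms, of z 0 "y - x"] by (simp add: two_point_def)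

lemma green_commute: "green z x y = green z y x"
  unfolding green_def
  by (rule sum.reindex_bij_witness[where i = rev and j = rev])
    (use saw_rev in \<open>auto simp: paths_def wt_def saw_def hd_rev last_rev\<close>)

lemma two_point_uminus:
  assumes "x \<in> Q"
  shows "two_point z (- x) = two_point z x"
  using green_eq_two_point[OF assms, of z 0] green_commute[of z x 0] by (simp add: two_point_def)

lemma paths_refl: "x \<in> Q \<Longrightarrow> paths x x = {[x]}"
proof (intro equalityI subsetI)
  fix p assume "x \<in> Q" "p \<in> paths x x"
  then show "p \<in> {[x]}"
    by (cases p) (auto simp: paths_def saw_def split: if_splits)
qed (auto simp: paths_def saw_def)

lemma green_refl: "x \<in> Q \<Longrightarrow> green z x x = 1"
  by (simp add: green_def paths_refl wt_def)

lemma two_point_0: "two_point z 0 = 1"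
  by (simp add: two_point_def green_refl zero_Q)

section \<open>Cutting walks at a vertex\<close>

lemma wt_join: "s \<noteq> [] \<Longrightarrow> t \<noteq> [] \<Longrightarrow> wt z (s @ tl t) = wt z s * wt z t"
  by (cases s; cases t) (auto simp: wt_def power_add)

lemma saw_splitE:
  assumes "saw p" "y \<in> set p"
  obtains a b where "p = a @ y # b" "saw (a @ [y])" "saw (y # b)"
  using assms split_list[of y p] saw_append_iff by metis

text \<open>Every walk through \<open>y\<close> is the join of its two pieces, so the joins of all
  pairs cover these walks, and joining multiplies weights.\<close>

lemma sum_paths_through_le:
  assumes "z \<ge> 0"
  shows "(\<Sum>p\<in>{p \<in> paths x x'. y \<in> set p}. wt z p) \<le> green z x y * green z y x'"
proof -
  let ?j = "\<lambda>(s, t). s @ tl t"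
  have "{p \<in> paths x x'. y \<in> set p} \<subseteq> ?j ` (paths x y \<times> paths y x')"
  proof
    fix p assume "p \<in> {p \<in> paths x x'. y \<in> set p}"
    then have p: "saw p" "hd p = x" "last p = x'" "y \<in> set p" by (auto simp: paths_def)
    obtain a b where ab: "p = a @ y # b" "saw (a @ [y])" "saw (y # b)"
      using saw_splitE[OF p(1,4)] .
    have "(a @ [y], y # b) \<in> paths x y \<times> paths y x'"
      using ab p by (cases a) (auto simp: paths_def)
    moreover have "p = ?j (a @ [y], y # b)" using ab by simp
    ultimately show "p \<in> ?j ` (paths x y \<times> paths y x')" by blast
  qed
  then have "(\<Sum>p\<in>{p \<in> paths x x'. y \<in> set p}. wt z p)
      \<le> (\<Sum>p\<in>?j ` (paths x y \<times> paths y x'). wt z p)"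
    using assms finite_paths by (intro sum_mono2) (auto intro: wt_nonneg)
  also have "\<dots> \<le> (\<Sum>st\<in>paths x y \<times> paths y x'. (wt z \<circ> ?j) st)"
    using assms finite_paths by (intro sum_image_le) (auto intro: wt_nonneg)
  also have "\<dots> = (\<Sum>(s, t)\<in>paths x y \<times> paths y x'. wt z s * wt z t)"
    by (rule sum.cong) (auto simp: wt_join paths_def saw_def)
  also have "\<dots> = green z x y * green z y x'"
    by (simp add: green_def sum_product sum.cartesian_product)
  finally show ?thesis .
qed

text \<open>Same cut with the total length fixed: the first piece determines the length of the
  second, whose total weight is then at most \<open>M\<close>.\<close>

lemma sum_paths_of_length_through_le:
  assumes "z \<ge> 0" and M: "\<And>m. (\<Sum>p\<in>paths_of_length m y. wt z p) \<le> M"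
  shows "(\<Sum>p\<in>{p \<in> paths_of_length n x. y \<in> set p}. wt z p) \<le> green z x y * M"
proof -
  let ?j = "\<lambda>(s, t). s @ tl t"
  \<comment> \<open>A first piece \<open>s\<close> has \<open>length s - 1\<close> steps, which
    leaves \<open>Suc n - length s\<close>. If \<open>s\<close> is too long the difference is 0, and
    such pairs only enlarge the bound.\<close>
  let ?R = "\<lambda>s. paths_of_length (Suc n - length s) y"
  have "{p \<in> paths_of_length n x. y \<in> set p} \<subseteq> ?j ` (Sigma (paths x y) ?R)"
  proof
    fix p assume "p \<in> {p \<in> paths_of_length n x. y \<in> set p}"
    then have p: "saw p" "hd p = x" "length p = Suc n" "y \<in> set p" by (auto simp: paths_of_length_def)
    obtain a b where ab: "p = a @ y # b" "saw (a @ [y])" "saw (y # b)"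
      using saw_splitE[OF p(1,4)] .
    have "(a @ [y], y # b) \<in> Sigma (paths x y) ?R"
      using ab p by (cases a) (auto simp: paths_def paths_of_length_def)
    moreover have "p = ?j (a @ [y], y # b)" using ab by simp
    ultimately show "p \<in> ?j ` (Sigma (paths x y) ?R)" by blast
  qed
  then have "(\<Sum>p\<in>{p \<in> paths_of_length n x. y \<in> set p}. wt z p)
      \<le> (\<Sum>p\<in>?j ` (Sigma (paths x y) ?R). wt z p)"
    using assms finite_paths finite_paths_of_length
    by (intro sum_mono2) (auto intro: wt_nonneg)
  also have "\<dots> \<le> (\<Sum>st\<in>Sigma (paths x y) ?R. (wt z \<circ> ?j) st)"
    using assms finite_paths finite_paths_of_length
    by (intro sum_image_le) (auto intro: wt_nonneg)
  also have "\<dots> = (\<Sum>(s, t)\<in>Sigma (paths x y) ?R. wt z s * wt z t)"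
    by (rule sum.cong) (auto simp: wt_join paths_def paths_of_length_def saw_def)
  also have "\<dots> = (\<Sum>s\<in>paths x y. wt z s * (\<Sum>t\<in>?R s. wt z t))"
    using finite_paths finite_paths_of_length by (simp add: sum.Sigma[symmetric] sum_distrib_left)
  also have "\<dots> \<le> (\<Sum>s\<in>paths x y. wt z s * M)"
    using assms by (intro sum_mono mult_left_mono wt_nonneg) auto
  also have "\<dots> = green z x y * M"
    by (simp add: green_def sum_distrib_right)
  finally show ?thesis .
qed

section \<open>The inclusion-exclusion expansion of the two-point function\<close>

lemma first_step:
  assumes "x \<noteq> 0"
  shows "green z 0 x = z * (\<Sum>e\<in>S. \<Sum>p\<in>{p \<in> paths e x. 0 \<notin> set p}. wt z p)"
proof -
  let ?T = "Sigma S (\<lambda>e. {p \<in> paths e x. 0 \<notin> set p})"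
  have "green z 0 x = (\<Sum>(e, p)\<in>?T. z * wt z p)"
    unfolding green_def
  proof (rule sum.reindex_bij_witness[where i = "\<lambda>(e, p). 0 # p" and j = "\<lambda>p. (hd (tl p), tl p)"])
    fix p assume p: "p \<in> paths 0 x"
    \<comment> \<open>Since \<open>x \<noteq> 0\<close>, the walk is not trivial and has a first
      step \<open>e\<close>; dropping the initial 0 is the bijection.\<close>
    then obtain e r where r: "p = 0 # e # r"
      using assms unfolding paths_def saw_def
      by (cases p; cases "tl p") (auto split: if_splits)
    show "(case (hd (tl p), tl p) of (e, p) \<Rightarrow> 0 # p) = p" using r by simp
    show "(hd (tl p), tl p) \<in> ?T"
      using p unfolding r by (auto simp: paths_def saw_def)
    show "(case (hd (tl p), tl p) of (e, p) \<Rightarrow> z * wt z p) = wt z p"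
      unfolding r by (simp add: wt_def)
  next
    fix ep assume "ep \<in> ?T"
    then obtain e p where ep: "ep = (e, p)" "e \<in> S" "p \<in> paths e x" "0 \<notin> set p" by auto
    then show "(hd (tl (case ep of (e, p) \<Rightarrow> 0 # p)), tl (case ep of (e, p) \<Rightarrow> 0 # p)) = ep"
      by (auto simp: paths_def)
    show "(case ep of (e, p) \<Rightarrow> 0 # p) \<in> paths 0 x"
      using ep zero_Q unfolding ep(1) by (cases p) (auto simp: paths_def saw_def)
  qed
  also have "\<dots> = z * (\<Sum>e\<in>S. \<Sum>p\<in>{p \<in> paths e x. 0 \<notin> set p}. wt z p)"
    using finite_S finite_paths by (simp add: sum.Sigma[symmetric] sum_distrib_left)
  finally show ?thesis .
qed

text \<open>With \<open>p\<close> the weight of the closed walks, the pairs (closed walk, walk to \<open>x\<close>) have weight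
  \<open>p * green z 0 x\<close>; \<open>remainder\<close> is what this overcounts, namely the pairs that meet away from \<open>0\<close>.\<close>

definition remainder :: "real \<Rightarrow> 'a \<Rightarrow> real" where
  "remainder z x = z * (\<Sum>e\<in>S. green z e 0 * green z 0 x -
     (\<Sum>p\<in>{p \<in> paths e x. 0 \<in> set p}. wt z p))"

text \<open>Three walks between 0 and \<open>y\<close>, one of them beginning with the step to
  \<open>e\<close>. The value at 0 is 0 because the pairs counted in the remainder always share 0;
  only further meetings are overcounted.\<close>

definition theta_kernel :: "real \<Rightarrow> 'a \<Rightarrow> real" where
  "theta_kernel z y = (if y = 0 then 0 else z * (\<Sum>e\<in>S. two_point z (y - e)) * (two_point z y)\<^sup>2)"

lemma green_e0: "e \<in> S \<Longrightarrow> green z e 0 = two_point z e"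
  using green_commute[of z e 0] by (simp add: two_point_def)

lemma sum_avoiding:
  "(\<Sum>p\<in>{p \<in> paths e x. 0 \<notin> set p}. wt z p) =
     green z e x - (\<Sum>p\<in>{p \<in> paths e x. 0 \<in> set p}. wt z p)"
proof -
  have "paths e x = {p \<in> paths e x. 0 \<notin> set p} \<union> {p \<in> paths e x. 0 \<in> set p}" by auto
  then have "green z e x = sum (wt z) ({p \<in> paths e x. 0 \<notin> set p} \<union> {p \<in> paths e x. 0 \<in> set p})"
    unfolding green_def by simp
  also have "\<dots> = (\<Sum>p\<in>{p \<in> paths e x. 0 \<notin> set p}. wt z p) + (\<Sum>p\<in>{p \<in> paths e x. 0 \<in> set p}. wt z p)"
    using finite_paths by (intro sum.union_disjoint) auto
  finally show ?thesis by simp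
qed

text \<open>Away from 0 this is \<open>first_step\<close> with the avoidance of 0 written as all
  walks minus those through 0. At \<open>x = 0\<close> every walk passes through 0, so the remainder
  vanishes, and the two sums over \<open>S\<close> cancel by reflection.\<close>

lemma two_point_expansion:
  assumes "x \<in> Q"
  shows "two_point z x = (if x = 0 then 1 else 0) + z * (\<Sum>e\<in>S. two_point z (x - e))
    - z * (\<Sum>e\<in>S. two_point z e) * two_point z x + remainder z x"
proof -
  have sub: "green z e x = two_point z (x - e)" if "e \<in> S" for e
    using that S_Q by (auto intro: green_eq_two_point)
  show ?thesis
  proof (cases "x = 0")
    case True
    have "{p \<in> paths e 0. 0 \<in> set p} = paths e 0" for e
      by (auto simp: paths_def saw_def) (metis last_in_set)
    then have "(\<Sum>p\<in>{p \<in> paths e x. 0 \<in> set p}. wt z p) = green z e 0" for e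
      using True by (simp add: green_def)
    then have "remainder z x = 0"
      using True by (simp add: remainder_def green_refl zero_Q)
    moreover have "(\<Sum>e\<in>S. two_point z (- e)) = (\<Sum>e\<in>S. two_point z e)"
      using S_Q by (intro sum.cong two_point_uminus) auto
    ultimately show ?thesis using True by (simp add: two_point_0)
  next
    case False
    have "two_point z x = z * (\<Sum>e\<in>S. two_point z (x - e) - (\<Sum>p\<in>{p \<in> paths e x. 0 \<in> set p}. wt z p))"
      unfolding two_point_def[of z x] first_step[OF False] sum_avoiding
      by (auto simp: sub intro!: sum.cong)
    moreover have "remainder z x = z * (\<Sum>e\<in>S. two_point z e * two_point z x -
         (\<Sum>p\<in>{p \<in> paths e x. 0 \<in> set p}. wt z p))"
      unfolding remainder_def by (auto simp: green_e0 two_point_def[of z x, symmetric] intro!: sum.cong)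
    ultimately show ?thesis using False
      by (simp add: sum_subtractf sum_distrib_right[symmetric] algebra_simps)
  qed
qed

lemma two_point_le_sum:
  assumes "z \<ge> 0" "x \<in> Q" "x \<noteq> 0"
  shows "two_point z x \<le> z * (\<Sum>e\<in>S. two_point z (x - e))"
proof -
  have "two_point z x = z * (\<Sum>e\<in>S. \<Sum>p\<in>{p \<in> paths e x. 0 \<notin> set p}. wt z p)"
    unfolding two_point_def using first_step[OF assms(3)] .
  also have "\<dots> \<le> z * (\<Sum>e\<in>S. green z e x)"
    unfolding green_def using assms finite_paths by (intro mult_left_mono sum_mono sum_mono2) (auto intro: wt_nonneg)
  also have "(\<Sum>e\<in>S. green z e x) = (\<Sum>e\<in>S. two_point z (x - e))"
    using S_Q by (intro sum.cong green_eq_two_point) auto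
  finally show ?thesis .
qed

lemma remainder_nonneg:
  assumes "z \<ge> 0"
  shows "remainder z x \<ge> 0"
  unfolding remainder_def using assms sum_paths_through_le[OF assms, of _ x 0]
  by (intro mult_nonneg_nonneg sum_nonneg) auto

text \<open>Union bound over a common vertex \<open>y\<close> other than 0.\<close>

lemma sum_meeting_pairs_le:
  assumes "z \<ge> 0" "finite A" "finite B" "\<And>p. p \<in> A \<Longrightarrow> set p \<subseteq> Q"
  shows "(\<Sum>(p, q)\<in>{(p, q) \<in> A \<times> B. \<not> set p \<inter> set q \<subseteq> {0}}. wt z p * wt z q)
    \<le> (\<Sum>y\<in>Q - {0}. (\<Sum>p\<in>{p \<in> A. y \<in> set p}. wt z p) * (\<Sum>q\<in>{q \<in> B. y \<in> set q}. wt z q))"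
proof -
  let ?X = "\<lambda>y. {p \<in> A. y \<in> set p} \<times> {q \<in> B. y \<in> set q}"
  let ?f = "\<lambda>(p, q). wt z p * wt z q"
  have "sum ?f {(p, q) \<in> A \<times> B. \<not> set p \<inter> set q \<subseteq> {0}} \<le> sum ?f (\<Union>y\<in>Q - {0}. ?X y)"
    using assms finite_Q by (intro sum_mono2) (auto intro!: mult_nonneg_nonneg wt_nonneg)
  also have "\<dots> = sum ?f (snd ` (Sigma (Q - {0}) ?X))"
    by (rule arg_cong[where f = "sum ?f"]) force
  also have "\<dots> \<le> sum (?f \<circ> snd) (Sigma (Q - {0}) ?X)"
    using assms finite_Q by (intro sum_image_le) (auto intro!: mult_nonneg_nonneg wt_nonneg)
  also have "\<dots> = (\<Sum>y\<in>Q - {0}. sum ?f (?X y))"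
    using assms finite_Q by (subst sum.Sigma) (auto intro!: sum.cong)
  finally show ?thesis by (simp add: sum_product sum.cartesian_product)
qed

text \<open>Two walks that share only 0 join to a self-avoiding walk through 0, and cutting at 0
  recovers the pair. This is the converse of the covering in
  \<open>sum_paths_through_le\<close>.\<close>

lemma avoiding_pairs_le:
  assumes "z \<ge> 0"
  shows "(\<Sum>(p, q)\<in>{(p, q) \<in> paths e 0 \<times> paths 0 x. set p \<inter> set q \<subseteq> {0}}. wt z p * wt z q)
    \<le> (\<Sum>p\<in>{p \<in> paths e x. 0 \<in> set p}. wt z p)"
proof -
  let ?N = "{(p, q) \<in> paths e 0 \<times> paths 0 x. set p \<inter> set q \<subseteq> {0}}"
  let ?j = "\<lambda>(p, q). p @ tl q"
  \<comment> \<open>0 is the last vertex of \<open>p\<close> and the first of \<open>q\<close>, and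
    by distinctness it occurs nowhere else in either.\<close>
  have dec: "\<exists>a t. p = a @ [0] \<and> q = 0 # t \<and> 0 \<notin> set a \<and> 0 \<notin> set t \<and> set a \<inter> set t = {}"
    if "(p, q) \<in> ?N" for p q
    using that unfolding paths_def saw_def
    by (intro exI[of _ "butlast p"] exI[of _ "tl q"])
      (cases p rule: rev_cases; cases q; auto)
  have inj: "inj_on ?j ?N"
  proof (rule inj_onI, clarify)
    fix p q p' q'
    assume eq: "p @ tl q = p' @ tl q'" and
      m: "p \<in> paths e 0" "q \<in> paths 0 x" "set p \<inter> set q \<subseteq> {0}"
      "p' \<in> paths e 0" "q' \<in> paths 0 x" "set p' \<inter> set q' \<subseteq> {0}"
    obtain a t where 1: "p = a @ [0]" "q = 0 # t" "0 \<notin> set a" "0 \<notin> set t"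
      using dec[of p q] m by auto
    obtain a' t' where 2: "p' = a' @ [0]" "q' = 0 # t'" "0 \<notin> set a'" "0 \<notin> set t'"
      using dec[of p' q'] m by auto
    have "a @ 0 # t = a' @ 0 # t'" using eq 1 2 by simp
    then have "a = a' \<and> t = t'" using 1 2
      by (metis append_Cons_eq_iff)
    then show "p = p' \<and> q = q'" using 1 2 by simp
  qed
  have img: "?j ` ?N \<subseteq> {p \<in> paths e x. 0 \<in> set p}"
  proof clarify
    fix p q assume m: "p \<in> paths e 0" "q \<in> paths 0 x" "set p \<inter> set q \<subseteq> {0}"
    then obtain a t where 1: "p = a @ [0]" "q = 0 # t" "set a \<inter> set t = {}"
      using dec[of p q] by auto
    have "saw (a @ 0 # t)" using 1 m by (subst saw_append_iff) (auto simp: paths_def)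
    moreover have "hd (a @ 0 # t) = e" "last (a @ 0 # t) = x"
      using 1 m by (cases a; auto simp: paths_def)+
    ultimately show "p @ tl q \<in> paths e x \<and> 0 \<in> set (p @ tl q)"
      using 1 by (simp add: paths_def)
  qed
  have "(\<Sum>(p, q)\<in>?N. wt z p * wt z q) = (\<Sum>pq\<in>?N. (wt z \<circ> ?j) pq)"
    by (rule sum.cong) (auto simp: wt_join paths_def saw_def)
  also have "\<dots> = sum (wt z) (?j ` ?N)"
    by (rule sum.reindex[OF inj, symmetric])
  also have "\<dots> \<le> (\<Sum>p\<in>{p \<in> paths e x. 0 \<in> set p}. wt z p)"
    using img assms finite_paths by (intro sum_mono2) (auto intro: wt_nonneg)
  finally show ?thesis .
qed

lemma sum_pairs_split:
  assumes "finite A" "finite B"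
  shows "sum (wt z) A * sum (wt z) B =
    (\<Sum>(p, q)\<in>{(p, q) \<in> A \<times> B. set p \<inter> set q \<subseteq> {0}}. wt z p * wt z q) +
    (\<Sum>(p, q)\<in>{(p, q) \<in> A \<times> B. \<not> set p \<inter> set q \<subseteq> {0}}. wt z p * wt z q)"
proof -
  have fin: "finite {(p, q) \<in> A \<times> B. P p q}" for P
    by (rule finite_subset[of _ "A \<times> B"]) (use assms in auto)
  have "sum (wt z) A * sum (wt z) B = (\<Sum>(p, q)\<in>A \<times> B. wt z p * wt z q)"
    by (simp add: sum_product sum.cartesian_product)
  also have "A \<times> B = {(p, q) \<in> A \<times> B. set p \<inter> set q \<subseteq> {0}} \<union>
      {(p, q) \<in> A \<times> B. \<not> set p \<inter> set q \<subseteq> {0}}" by auto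
  also have "(\<Sum>(p, q)\<in>\<dots>. wt z p * wt z q) =
    (\<Sum>(p, q)\<in>{(p, q) \<in> A \<times> B. set p \<inter> set q \<subseteq> {0}}. wt z p * wt z q) +
    (\<Sum>(p, q)\<in>{(p, q) \<in> A \<times> B. \<not> set p \<inter> set q \<subseteq> {0}}. wt z p * wt z q)"
    by (rule sum.union_disjoint[OF fin fin]) auto
  finally show ?thesis .
qed

text \<open>By \<open>avoiding_pairs_le\<close> only pairs meeting at some
  \<open>y \<noteq> 0\<close> survive the subtraction. Cutting both walks at \<open>y\<close> gives
  four factors: \<open>e\<close> to \<open>y\<close>, \<open>y\<close> to 0, 0 to \<open>y\<close>,
  \<open>y\<close> to \<open>x\<close>; the first three form the kernel.\<close>

lemma remainder_le:
  assumes z: "z \<ge> 0" and x: "x \<in> Q"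
  shows "remainder z x \<le> (\<Sum>y\<in>Q. theta_kernel z y * two_point z (x - y))"
proof -
  have step: "green z e 0 * green z 0 x - (\<Sum>p\<in>{p \<in> paths e x. 0 \<in> set p}. wt z p)
      \<le> (\<Sum>y\<in>Q - {0}. two_point z (y - e) * (two_point z y)\<^sup>2 * two_point z (x - y))"
    if e: "e \<in> S" for e
  proof -
    have "green z e 0 * green z 0 x - (\<Sum>p\<in>{p \<in> paths e x. 0 \<in> set p}. wt z p)
      \<le> (\<Sum>(p, q)\<in>{(p, q) \<in> paths e 0 \<times> paths 0 x. \<not> set p \<inter> set q \<subseteq> {0}}. wt z p * wt z q)"
      using sum_pairs_split[OF finite_paths finite_paths, of z e 0 0 x] avoiding_pairs_le[OF z, of e x]
      by (simp add: green_def)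
    also have "\<dots> \<le> (\<Sum>y\<in>Q - {0}. (\<Sum>p\<in>{p \<in> paths e 0. y \<in> set p}. wt z p) *
        (\<Sum>q\<in>{q \<in> paths 0 x. y \<in> set q}. wt z q))"
      using z finite_paths by (intro sum_meeting_pairs_le) (auto simp: paths_def saw_def)
    also have "\<dots> \<le> (\<Sum>y\<in>Q - {0}. (green z e y * green z y 0) * (green z 0 y * green z y x))"
      using z by (intro sum_mono mult_mono sum_paths_through_le sum_nonneg wt_nonneg
          mult_nonneg_nonneg green_nonneg) auto
    also have "\<dots> = (\<Sum>y\<in>Q - {0}. two_point z (y - e) * (two_point z y)\<^sup>2 * two_point z (x - y))"
    proof (rule sum.cong)
      fix y assume "y \<in> Q - {0}"
      then show "(green z e y * green z y 0) * (green z 0 y * green z y x) =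
          two_point z (y - e) * (two_point z y)\<^sup>2 * two_point z (x - y)"
        using e S_Q green_commute[of z y 0] green_eq_two_point[of e z y] green_eq_two_point[of y z x]
        by (auto simp: two_point_def[of z y] power2_eq_square)
    qed simp
    finally show ?thesis .
  qed
  have "remainder z x \<le> z * (\<Sum>e\<in>S. \<Sum>y\<in>Q - {0}. two_point z (y - e) * (two_point z y)\<^sup>2 * two_point z (x - y))"
    unfolding remainder_def using z step by (intro mult_left_mono sum_mono)
  also have "\<dots> = (\<Sum>y\<in>Q - {0}. theta_kernel z y * two_point z (x - y))"
    by (subst sum.swap) (auto simp: theta_kernel_def sum_distrib_left sum_distrib_right mult_ac intro!: sum.cong)
  also have "\<dots> = (\<Sum>y\<in>Q. theta_kernel z y * two_point z (x - y))"
    using finite_Q by (intro sum.mono_neutral_left) (auto simp: theta_kernel_def)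
  finally show ?thesis .
qed

section \<open>Walks by length: the quadratic inequality for the maximal weight\<close>

definition level_weight :: "real \<Rightarrow> nat \<Rightarrow> real" where
  "level_weight z n = (\<Sum>p\<in>paths_of_length n 0. wt z p)"

lemma level_weight_eq: "level_weight z n = real (card (paths_of_length n 0)) * z ^ n"
  by (simp add: level_weight_def wt_def paths_of_length_def)

lemma paths_of_length_map_add:
  assumes "p \<in> paths_of_length n x" "a \<in> Q"
  shows "map (\<lambda>v. v + a) p \<in> paths_of_length n (x + a)"
  using assms saw_map_add[of p a] by (auto simp: paths_of_length_def hd_map saw_def)

lemma sum_paths_of_length:
  assumes "y \<in> Q"
  shows "(\<Sum>p\<in>paths_of_length n y. wt z p) = level_weight z n"
  unfolding level_weight_def
  by (rule sum.reindex_bij_witness[where j = "map (\<lambda>v. v + - y)" and i = "map (\<lambda>v. v + y)"])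
    (use assms paths_of_length_map_add[of _ n 0 y] paths_of_length_map_add[of _ n y "- y"] uminus_Q
     in \<open>auto simp: comp_def wt_def\<close>)

lemma length_saw_le: "saw p \<Longrightarrow> length p \<le> card Q"
  unfolding saw_def using card_mono[OF finite_Q, of "set p"] by (simp add: distinct_card)

lemma level_weight_eq_0: "n \<ge> card Q \<Longrightarrow> level_weight z n = 0"
proof -
  assume "n \<ge> card Q"
  then have "paths_of_length n 0 = {}"
    using length_saw_le by (fastforce simp: paths_of_length_def)
  then show ?thesis by (simp add: level_weight_def)
qed

text \<open>Both sides sum over all walks from 0, grouped by endpoint or by length.\<close>

lemma sum_two_point: "(\<Sum>x\<in>Q. two_point z x) = (\<Sum>n<card Q. level_weight z n)"
proof -
  let ?P = "{p. saw p \<and> hd p = 0}"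
  have fin: "finite ?P" by (rule finite_subset[OF _ finite_saw]) auto
  have l: "last ` ?P \<subseteq> Q" by (auto simp: saw_def)
  have n: "(\<lambda>p. length p - 1) ` ?P \<subseteq> {..<card Q}"
  proof clarify
    fix p assume "saw p"
    then show "length p - 1 < card Q"
      using length_saw_le[of p] by (cases p) (auto simp: saw_def)
  qed
  have "(\<Sum>x\<in>Q. two_point z x) = sum (wt z) ?P"
    unfolding sum.group[OF fin finite_Q l, of "wt z", symmetric]
    unfolding two_point_def green_def paths_def
    by (intro sum.cong) auto
  also have "\<dots> = (\<Sum>n<card Q. level_weight z n)"
  proof -
    have "{p \<in> ?P. length p - 1 = n} = paths_of_length n 0" for n
      by (auto simp: paths_of_length_def saw_def Suc_diff_Suc length_greater_0_conv[symmetric]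
          simp del: length_greater_0_conv)
    then show ?thesis
      using sum.group[OF fin finite_lessThan n, of "wt z"] by (simp add: level_weight_def)
  qed
  finally show ?thesis .
qed

text \<open>The bubble diagram without its term at 0, which is always 1; only this part can be
  small.\<close>

definition bubble :: "real \<Rightarrow> real" where
  "bubble z = (\<Sum>y\<in>Q - {0}. (two_point z y)\<^sup>2)"

lemma bubble_nonneg: "bubble z \<ge> 0"
  unfolding bubble_def by (intro sum_nonneg) auto

lemma level_weight_nonneg: "z \<ge> 0 \<Longrightarrow> level_weight z n \<ge> 0"
  unfolding level_weight_def by (intro sum_nonneg wt_nonneg)

text \<open>The joint 0 sits at position \<open>m\<close> and is shifted to \<open>- last p\<close>,
  so the translation can be read off the joined walk; the cut is then fixed by the common
  length.\<close>

lemma inj_on_join_avoiding_pairs: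
  "inj_on (\<lambda>(p, q). map (\<lambda>v. v - last p) (rev p @ tl q))
     {(p, q) \<in> paths_of_length m 0 \<times> paths_of_length m 0. set p \<inter> set q \<subseteq> {0}}"
proof (rule inj_onI, clarify)
  fix p q p' q'
  assume eq: "map (\<lambda>v. v - last p) (rev p @ tl q) = map (\<lambda>v. v - last p') (rev p' @ tl q')"
    and m: "p \<in> paths_of_length m 0" "q \<in> paths_of_length m 0"
      "p' \<in> paths_of_length m 0" "q' \<in> paths_of_length m 0"
  have mid: "map (\<lambda>v. v - last p) (rev p @ tl q) ! m = - last p"
    if "p \<in> paths_of_length m 0" for p q
    using that by (cases p) (auto simp: paths_of_length_def nth_append)
  have "- last p = - last p'"
    using mid[OF m(1), of q] mid[OF m(3), of q'] eq by simp
  then have "map (\<lambda>v. v - last p) (rev p @ tl q) = map (\<lambda>v. v - last p) (rev p' @ tl q')"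
    using eq by simp
  then have "rev p @ tl q = rev p' @ tl q'"
    by (rule map_injective) (auto simp: inj_on_def)
  moreover have "length (rev p) = length (rev p')"
    using m by (simp add: paths_of_length_def)
  ultimately have "rev p = rev p'" "tl q = tl q'" by (auto simp: append_eq_append_conv)
  then show "p = p' \<and> q = q'"
    using m by (cases q; cases q') (auto simp: paths_of_length_def)
qed

text \<open>Pairs meeting only at 0 become one walk of \<open>2 * m\<close> steps, by reversing the
  first, appending the second and translating the start to 0. For the other pairs, each walk through
  \<open>y\<close> contributes at most \<open>two_point z y * M\<close>.\<close>

lemma level_weight_square_le:
  assumes z: "z \<ge> 0" and M: "\<And>m. level_weight z m \<le> M"
  shows "(level_weight z m)\<^sup>2 \<le> level_weight z (2 * m) + bubble z * M\<^sup>2"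
proof -
  let ?A = "paths_of_length m 0"
  let ?N = "{(p, q) \<in> ?A \<times> ?A. set p \<inter> set q \<subseteq> {0}}"
  let ?j = "\<lambda>(p, q). map (\<lambda>v. v - last p) (rev p @ tl q)"
  have M0: "M \<ge> 0" using M[of 0] level_weight_nonneg[OF z, of 0] by linarith
  have img: "?j ` ?N \<subseteq> paths_of_length (2 * m) 0"
  proof clarify
    fix p q assume m: "p \<in> ?A" "q \<in> ?A" "set p \<inter> set q \<subseteq> {0}"
    obtain a t where 1: "p = 0 # a" "q = 0 # t"
      using m by (cases p; cases q) (auto simp: paths_of_length_def saw_def)
    have "saw (rev a @ 0 # t)"
      using m 1 saw_rev[of p] by (subst saw_append_iff) (auto simp: paths_of_length_def saw_def)
    then have "rev p @ tl q \<in> paths_of_length (2 * m) (last p)"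
      using m 1 by (auto simp: paths_of_length_def hd_append hd_rev last_rev)
    moreover have "- last p \<in> Q"
      using m by (auto simp: paths_of_length_def saw_def intro!: uminus_Q)
    ultimately show "map (\<lambda>v. v - last p) (rev p @ tl q) \<in> paths_of_length (2 * m) 0"
      using paths_of_length_map_add[of "rev p @ tl q" "2 * m" "last p" "- last p"] by simp
  qed
  have "(\<Sum>(p, q)\<in>?N. wt z p * wt z q) = (\<Sum>pq\<in>?N. (wt z \<circ> ?j) pq)"
  proof (rule sum.cong)
    fix pq assume "pq \<in> ?N"
    then show "(case pq of (p, q) \<Rightarrow> wt z p * wt z q) = (wt z \<circ> ?j) pq"
      using wt_join[of "rev (fst pq)" "snd pq" z]
      by (auto simp: paths_of_length_def wt_def saw_def)
  qed simp
  also have "\<dots> = sum (wt z) (?j ` ?N)"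
    by (rule sum.reindex[OF inj_on_join_avoiding_pairs, symmetric])
  also have "\<dots> \<le> level_weight z (2 * m)"
    unfolding level_weight_def
    using img z finite_paths_of_length by (intro sum_mono2) (auto intro: wt_nonneg)
  finally have good: "(\<Sum>(p, q)\<in>?N. wt z p * wt z q) \<le> level_weight z (2 * m)" .
  have thr: "(\<Sum>p\<in>{p \<in> ?A. y \<in> set p}. wt z p) \<le> two_point z y * M" if "y \<in> Q" for y
    unfolding two_point_def
    using z M that by (intro sum_paths_of_length_through_le) (simp_all add: sum_paths_of_length)
  have "(\<Sum>(p, q)\<in>{(p, q) \<in> ?A \<times> ?A. \<not> set p \<inter> set q \<subseteq> {0}}. wt z p * wt z q)
      \<le> (\<Sum>y\<in>Q - {0}. (\<Sum>p\<in>{p \<in> ?A. y \<in> set p}. wt z p) * (\<Sum>q\<in>{q \<in> ?A. y \<in> set q}. wt z q))"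
    using z finite_paths_of_length
    by (intro sum_meeting_pairs_le) (auto simp: paths_of_length_def saw_def)
  also have "\<dots> \<le> (\<Sum>y\<in>Q - {0}. (two_point z y * M) * (two_point z y * M))"
    using z thr M0 by (intro sum_mono mult_mono mult_nonneg_nonneg sum_nonneg wt_nonneg two_point_nonneg) auto
  also have "\<dots> = bubble z * M\<^sup>2"
    by (simp add: bubble_def sum_distrib_left power2_eq_square mult_ac)
  finally show ?thesis
    using sum_pairs_split[OF finite_paths_of_length finite_paths_of_length, of z m 0 m 0] good
    by (simp add: level_weight_def power2_eq_square)
qed

lemma level_weight_le:
  assumes z: "z \<ge> 0" and b: "bubble z < 1"
  shows "level_weight z n \<le> 1 / (1 - bubble z)"
proof -
  \<comment> \<open>The index \<open>card Q\<close>, where the weight is 0, stands for the whole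
    tail, so this finite maximum bounds all weights.\<close>
  define M where "M = Max (level_weight z ` {..card Q})"
  have fin: "finite (level_weight z ` {..card Q})" "level_weight z ` {..card Q} \<noteq> {}" by auto
  have le: "level_weight z n \<le> M" for n
  proof (cases "n \<le> card Q")
    case True
    then show ?thesis unfolding M_def by (intro Max_ge fin) auto
  next
    case False
    then have "level_weight z n = level_weight z (card Q)" by (simp add: level_weight_eq_0)
    then show ?thesis unfolding M_def by (intro Max_ge fin) auto
  qed
  have "M \<in> level_weight z ` {..card Q}" unfolding M_def by (rule Max_in[OF fin])
  then obtain m where m: "M = level_weight z m" by auto
  have "M\<^sup>2 \<le> M + bubble z * M\<^sup>2"
    using level_weight_square_le[OF z le, of m] le[of "2 * m"] m by simp
  then have "M * (M * (1 - bubble z)) \<le> M * 1" by (simp add: algebra_simps power2_eq_square)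
  moreover have "M \<ge> 0" using m level_weight_nonneg[OF z] by simp
  ultimately have "M * (1 - bubble z) \<le> 1"
    by (cases "M = 0") (auto simp: mult_le_cancel_left)
  then have "M \<le> 1 / (1 - bubble z)" using b by (simp add: field_simps)
  then show ?thesis using le[of n] by linarith
qed

section \<open>Estimates in l2 and pointwise\<close>

lemma convolution_l2_le:
  fixes k f :: "'a \<Rightarrow> real"
  assumes k: "\<And>y. k y \<ge> 0"
  shows "(\<Sum>x\<in>Q. (\<Sum>y\<in>Q. k y * f (x - y))\<^sup>2) \<le> (\<Sum>y\<in>Q. k y)\<^sup>2 * (\<Sum>x\<in>Q. (f x)\<^sup>2)"
proof -
  have "(\<Sum>y\<in>Q. k y * f (x - y))\<^sup>2 \<le> (\<Sum>y\<in>Q. k y) * (\<Sum>y\<in>Q. k y * (f (x - y))\<^sup>2)" for x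
  proof -
    \<comment> \<open>Splitting the kernel into two square roots lets Cauchy-Schwarz keep one factor
      of \<open>k\<close> with the square of \<open>f\<close>; this is Young's inequality for l1 and
      l2.\<close>
    have "(\<Sum>y\<in>Q. k y * f (x - y))\<^sup>2 = (\<Sum>y\<in>Q. sqrt (k y) * (sqrt (k y) * f (x - y)))\<^sup>2"
      using k by (simp add: mult.assoc[symmetric])
    also have "\<dots> \<le> (\<Sum>y\<in>Q. (sqrt (k y))\<^sup>2) * (\<Sum>y\<in>Q. (sqrt (k y) * f (x - y))\<^sup>2)"
      by (rule Cauchy_Schwarz_ineq_sum)
    finally show ?thesis using k by (simp add: power_mult_distrib)
  qed
  then have "(\<Sum>x\<in>Q. (\<Sum>y\<in>Q. k y * f (x - y))\<^sup>2)
      \<le> (\<Sum>x\<in>Q. (\<Sum>y\<in>Q. k y) * (\<Sum>y\<in>Q. k y * (f (x - y))\<^sup>2))"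
    by (intro sum_mono)
  also have "\<dots> = (\<Sum>y\<in>Q. k y) * (\<Sum>y\<in>Q. k y * (\<Sum>x\<in>Q. (f (x - y))\<^sup>2))"
    unfolding sum_distrib_left[symmetric] by (subst sum.swap) (simp add: sum_distrib_left)
  also have "(\<Sum>y\<in>Q. k y * (\<Sum>x\<in>Q. (f (x - y))\<^sup>2)) = (\<Sum>y\<in>Q. k y * (\<Sum>x\<in>Q. (f x)\<^sup>2))"
    by (intro sum.cong refl arg_cong2[where f = "(*)"] sum_shift_Q)
  finally show ?thesis by (simp add: sum_distrib_right[symmetric] power2_eq_square mult_ac)
qed

lemma sum_two_point_square: "(\<Sum>x\<in>Q. (two_point z x)\<^sup>2) = 1 + bubble z"
  using finite_Q zero_Q by (simp add: bubble_def sum.remove two_point_0)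

lemma remainder_l2_le:
  assumes "z \<ge> 0"
  shows "(\<Sum>x\<in>Q. (remainder z x)\<^sup>2) \<le> (\<Sum>y\<in>Q. theta_kernel z y)\<^sup>2 * (1 + bubble z)"
proof -
  have "theta_kernel z y \<ge> 0" for y
    unfolding theta_kernel_def using assms by (auto intro!: mult_nonneg_nonneg sum_nonneg two_point_nonneg)
  then have "(\<Sum>x\<in>Q. (\<Sum>y\<in>Q. theta_kernel z y * two_point z (x - y))\<^sup>2)
      \<le> (\<Sum>y\<in>Q. theta_kernel z y)\<^sup>2 * (\<Sum>x\<in>Q. (two_point z x)\<^sup>2)"
    by (rule convolution_l2_le)
  moreover have "(\<Sum>x\<in>Q. (remainder z x)\<^sup>2) \<le> (\<Sum>x\<in>Q. (\<Sum>y\<in>Q. theta_kernel z y * two_point z (x - y))\<^sup>2)"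
    using assms by (intro sum_mono power_mono remainder_le remainder_nonneg)
  ultimately show ?thesis by (simp add: sum_two_point_square)
qed

text \<open>At \<open>y = e\<close> the first factor is 1 and the other two are at most
  \<open>s\<close>. At every other \<open>y\<close> the first factor is at most \<open>s\<close> and
  the remaining squares sum to \<open>bubble z\<close>.\<close>

lemma sum_theta_kernel_le:
  assumes z: "z \<ge> 0" and s: "\<And>x. x \<in> Q \<Longrightarrow> x \<noteq> 0 \<Longrightarrow> two_point z x \<le> s" "s \<ge> 0"
  shows "(\<Sum>y\<in>Q. theta_kernel z y) \<le> z * real (card S) * s * (s + bubble z)"
proof -
  have "(\<Sum>y\<in>Q. theta_kernel z y) = (\<Sum>y\<in>Q - {0}. z * (\<Sum>e\<in>S. two_point z (y - e)) * (two_point z y)\<^sup>2)"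
    using finite_Q by (intro sum.mono_neutral_cong_right) (auto simp: theta_kernel_def)
  also have "\<dots> = z * (\<Sum>e\<in>S. \<Sum>y\<in>Q - {0}. two_point z (y - e) * (two_point z y)\<^sup>2)"
    by (subst sum.swap) (simp add: sum_distrib_left sum_distrib_right mult_ac)
  also have "\<dots> \<le> z * (\<Sum>e\<in>S. s * (s + bubble z))"
  proof (intro mult_left_mono sum_mono z)
    fix e assume e: "e \<in> S"
    have eQ: "e \<in> Q" "e \<noteq> 0" using e S_Q zero_S by auto
    have "(\<Sum>y\<in>Q - {0}. two_point z (y - e) * (two_point z y)\<^sup>2)
        \<le> (\<Sum>y\<in>Q - {0}. (if y = e then s\<^sup>2 else 0) + s * (two_point z y)\<^sup>2)"
    proof (rule sum_mono)
      fix y assume y: "y \<in> Q - {0}"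
      show "two_point z (y - e) * (two_point z y)\<^sup>2 \<le> (if y = e then s\<^sup>2 else 0) + s * (two_point z y)\<^sup>2"
      proof (cases "y = e")
        case True
        have "(two_point z e)\<^sup>2 \<le> s\<^sup>2" using s eQ two_point_nonneg[OF z] by (intro power_mono) auto
        then show ?thesis using True s by (simp add: two_point_0 add_increasing2)
      next
        case False
        then have "two_point z (y - e) \<le> s" using y eQ diff_Q by (intro s) auto
        then show ?thesis using False by (simp add: mult_right_mono)
      qed
    qed
    also have "\<dots> = s\<^sup>2 + s * bubble z"
      using eQ finite_Q by (simp add: sum.distrib bubble_def sum_distrib_left)
    finally show "(\<Sum>y\<in>Q - {0}. two_point z (y - e) * (two_point z y)\<^sup>2) \<le> s * (s + bubble z)"
      by (simp add: algebra_simps power2_eq_square)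
  qed
  also have "\<dots> = z * real (card S) * s * (s + bubble z)" by simp
  finally show ?thesis .
qed

text \<open>Two iterations of \<open>two_point_le_sum\<close>, with the value 1 at 0 split off each
  time. With \<open>z\<close> of order 1/N, Cauchy-Schwarz over one step would give only order
  1/sqrt N; two steps give 1/N.\<close>

lemma two_point_sup_le:
  assumes z: "z \<ge> 0" and x: "x \<in> Q" "x \<noteq> 0"
  shows "two_point z x \<le> z + z\<^sup>2 * real (card S) +
    z\<^sup>2 * (\<Sum>e\<in>S. \<Sum>f\<in>S. if x - e - f = 0 then 0 else two_point z (x - e - f))"
proof -
  let ?h = "\<lambda>x. if x = 0 then 0 else two_point z x"
  have step: "?h x \<le> z + z * (\<Sum>e\<in>S. ?h (x - e))" if "x \<in> Q" for x
  proof (cases "x = 0")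
    case True
    then show ?thesis using z two_point_nonneg[OF z] by (auto intro!: add_nonneg_nonneg mult_nonneg_nonneg sum_nonneg)
  next
    case False
    have "two_point z x \<le> z * (\<Sum>e\<in>S. two_point z (x - e))" by (rule two_point_le_sum[OF z that False])
    also have "\<dots> = z * (\<Sum>e\<in>S. (if x = e then 1 else 0) + ?h (x - e))"
      by (intro arg_cong2[where f = "(*)"] sum.cong refl) (auto simp: two_point_0)
    also have "\<dots> = z * ((if x \<in> S then 1 else 0) + (\<Sum>e\<in>S. ?h (x - e)))"
      using finite_S by (simp add: sum.distrib)
    also have "\<dots> \<le> z * (1 + (\<Sum>e\<in>S. ?h (x - e)))" using z by (intro mult_left_mono) auto
    finally show ?thesis using False by (simp add: algebra_simps)
  qed
  have "two_point z x \<le> z + z * (\<Sum>e\<in>S. ?h (x - e))" using step[OF x(1)] x by simp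
  also have "\<dots> \<le> z + z * (\<Sum>e\<in>S. z + z * (\<Sum>f\<in>S. ?h (x - e - f)))"
    using z x S_Q diff_Q by (intro add_left_mono mult_left_mono sum_mono step) auto
  also have "\<dots> = z + z\<^sup>2 * real (card S) + z\<^sup>2 * (\<Sum>e\<in>S. \<Sum>f\<in>S. ?h (x - e - f))"
    by (simp add: sum.distrib sum_distrib_left[symmetric] algebra_simps power2_eq_square)
  finally show ?thesis .
qed

text \<open>Extracting one step matters: in Walsh variables it multiplies by
  \<open>N - 2 * card A\<close>, which is typically of order sqrt N. Without it, the delta at 0
  would contribute a constant.\<close>

lemma bubble_le:
  assumes "z \<ge> 0"
  shows "bubble z \<le> z\<^sup>2 * (\<Sum>x\<in>Q. (\<Sum>e\<in>S. two_point z (x - e))\<^sup>2)"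
proof -
  have "bubble z \<le> (\<Sum>x\<in>Q - {0}. (z * (\<Sum>e\<in>S. two_point z (x - e)))\<^sup>2)"
    unfolding bubble_def using assms
    by (intro sum_mono power_mono two_point_le_sum two_point_nonneg) auto
  also have "\<dots> \<le> (\<Sum>x\<in>Q. (z * (\<Sum>e\<in>S. two_point z (x - e)))\<^sup>2)"
    using finite_Q by (intro sum_mono2) auto
  finally show ?thesis by (simp add: power_mult_distrib sum_distrib_left[symmetric])
qed

lemma continuous_on_two_point: "continuous_on A (\<lambda>z. two_point z x)"
  unfolding two_point_def green_def wt_def by (intro continuous_intros)

lemma continuous_on_bubble: "continuous_on A bubble"
  unfolding bubble_def by (intro continuous_intros continuous_on_two_point)

end

section \<open>The hypercube\<close>

text \<open>Zero padding makes each cube a subgroup of the pointwise group on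
  \<open>nat \<Rightarrow> bit\<close>, as the Cayley locale requires.\<close>

definition cube :: "nat \<Rightarrow> (nat \<Rightarrow> bit) set" where
  "cube N = {x. \<forall>i\<ge>N. x i = 0}"

definition flip :: "nat \<Rightarrow> nat \<Rightarrow> bit" where
  "flip i = (\<lambda>j. if j = i then 1 else 0)"

definition flips :: "nat \<Rightarrow> (nat \<Rightarrow> bit) set" where
  "flips N = flip ` {..<N}"

definition bits_of_list :: "bit list \<Rightarrow> nat \<Rightarrow> bit" where
  "bits_of_list l = (\<lambda>i. if i < length l then l ! i else 0)"

lemma uminus_bit_fun [simp]: "- x = (x :: nat \<Rightarrow> bit)"
  by (rule ext) simp

lemma map_bits_of_list: "length l = N \<Longrightarrow> map (bits_of_list l) [0..<N] = l"
  by (rule nth_equalityI) (auto simp: bits_of_list_def)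

lemma bits_of_list_map: "x \<in> cube N \<Longrightarrow> bits_of_list (map x [0..<N]) = x"
  by (rule ext) (auto simp: bits_of_list_def cube_def)

lemma bits_of_list_in_cube: "l \<in> hypercube N \<Longrightarrow> bits_of_list l \<in> cube N"
  by (simp add: bits_of_list_def cube_def hypercube_def)

lemma bits_of_list_inject:
  "a \<in> hypercube N \<Longrightarrow> b \<in> hypercube N \<Longrightarrow> bits_of_list a = bits_of_list b \<longleftrightarrow> a = b"
  unfolding hypercube_def using map_bits_of_list by (metis mem_Collect_eq)

lemma bij_betw_bits_of_list: "bij_betw bits_of_list (hypercube N) (cube N)"
  by (rule bij_betwI[where g = "\<lambda>x. map x [0..<N]"])
    (auto simp: bits_of_list_in_cube bits_of_list_map map_bits_of_list hypercube_def)

lemma finite_cube: "finite (cube N)"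
  using bij_betw_finite[OF bij_betw_bits_of_list] finite_hypercube by blast

lemma card_cube: "card (cube N) = 2 ^ N"
  using bij_betw_same_card[OF bij_betw_bits_of_list] card_hypercube by metis

lemma inj_flip: "inj flip"
proof (rule injI)
  fix i j assume "flip i = flip j"
  then have "flip i i = flip j i" by simp
  then show "i = j" by (auto simp: flip_def split: if_splits)
qed

lemma card_flips: "card (flips N) = N"
  unfolding flips_def by (simp add: card_image inj_on_subset[OF inj_flip])

lemma sum_flips: "sum f (flips N) = (\<Sum>i<N. f (flip i))"
  unfolding flips_def by (subst sum.reindex) (auto simp: inj_on_subset[OF inj_flip])

lemma cayley_cube: "cayley (cube N) (flips N)"
proof
  show "0 \<notin> flips N"
  proof
    assume "0 \<in> flips N"
    then obtain i where "flip i = 0" by (auto simp: flips_def)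
    then have "flip i i = 0" by simp
    then show False by (simp add: flip_def)
  qed
  show "finite (cube N)" by (rule finite_cube)
qed (auto simp: cube_def flips_def flip_def)

lemma Collect_eq_singleton_iff: "{i. d i = (1::bit)} = {k} \<longleftrightarrow> d = flip k"
proof -
  have "(d i = 1 \<longleftrightarrow> i = k) \<longleftrightarrow> d i = (if i = k then 1 else 0)" for i
    by (cases "d i") auto
  then show ?thesis by (auto simp: fun_eq_iff set_eq_iff flip_def)
qed

text \<open>Weight 1 means that the set of ones is a singleton \<open>{k}\<close>, so the difference
  is \<open>flip k\<close>; the padding forces \<open>k < N\<close>.\<close>

lemma adjacent_iff:
  assumes "a \<in> hypercube N" "b \<in> hypercube N"
  shows "hc_weight (hc_diff a b) = 1 \<longleftrightarrow> bits_of_list a - bits_of_list b \<in> flips N"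
proof -
  have l: "length a = N" "length b = N" using assms by (auto simp: hypercube_def)
  have "{i. i < length (hc_diff a b) \<and> hc_diff a b ! i = 1} = {i. (bits_of_list a - bits_of_list b) i = 1}"
    using l by (auto simp: hc_diff_def bits_of_list_def)
  then have "hc_weight (hc_diff a b) = 1 \<longleftrightarrow> (\<exists>k. {i. (bits_of_list a - bits_of_list b) i = 1} = {k})"
    by (simp add: hc_weight_def card_1_singleton_iff)
  also have "\<dots> \<longleftrightarrow> (\<exists>k. bits_of_list a - bits_of_list b = flip k)"
    by (simp only: Collect_eq_singleton_iff)
  also have "\<dots> \<longleftrightarrow> bits_of_list a - bits_of_list b \<in> flips N"
  proof -
    have "k < N" if "bits_of_list a - bits_of_list b = flip k" for k
    proof (rule ccontr)
      assume "\<not> k < N"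
      then have "(bits_of_list a - bits_of_list b) k = 0" using l by (simp add: bits_of_list_def)
      then show False unfolding that by (simp add: flip_def)
    qed
    then show ?thesis by (auto simp: flips_def)
  qed
  finally show ?thesis .
qed

lemma saw_count_eq_card_paths:
  "saw_count N n = card (cayley.paths_of_length (cube N) (flips N) n 0)"
proof -
  interpret cayley "cube N" "flips N" by (rule cayley_cube)
  let ?F = "\<lambda>\<omega>. map (\<lambda>i. bits_of_list (\<omega> i)) [0..<Suc n]"
  \<comment> \<open>The restriction gives the values outside \<open>{0..n}\<close> that the
    extensional function space prescribes.\<close>
  let ?G = "\<lambda>p. restrict (\<lambda>i. map (p ! i) [0..<N]) {0..n}"
  let ?A = "{\<omega> \<in> self_avoiding_walks N n. \<omega> 0 = hc_zero N}"
  have zero: "bits_of_list (hc_zero N) = 0" by (rule ext) (simp add: bits_of_list_def hc_zero_def)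
  have "bij_betw ?F ?A (paths_of_length n 0)"
  proof (rule bij_betwI[where g = ?G])
    show "?F \<in> ?A \<rightarrow> paths_of_length n 0"
    proof
      fix \<omega> assume "\<omega> \<in> ?A"
      then have w: "\<And>i. i \<le> n \<Longrightarrow> \<omega> i \<in> hypercube N"
        and st: "\<And>i. 1 \<le> i \<Longrightarrow> i \<le> n \<Longrightarrow> hc_weight (hc_diff (\<omega> i) (\<omega> (i - 1))) = 1"
        and ne: "\<And>i j. i \<le> n \<Longrightarrow> j \<le> n \<Longrightarrow> i \<noteq> j \<Longrightarrow> \<omega> i \<noteq> \<omega> j"
        and z: "\<omega> 0 = hc_zero N"
        by (auto simp: self_avoiding_walks_def PiE_def Pi_def)
      have nth: "?F \<omega> ! i = bits_of_list (\<omega> i)" if "i \<le> n" for i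
        using that by (simp del: upt_Suc)
      have "distinct (?F \<omega>)"
        unfolding distinct_conv_nth
      proof (intro allI impI)
        fix i j assume "i < length (?F \<omega>)" "j < length (?F \<omega>)" "i \<noteq> j"
        then have "i \<le> n" "j \<le> n" "\<omega> i \<noteq> \<omega> j" using ne by auto
        then show "?F \<omega> ! i \<noteq> ?F \<omega> ! j"
          using bits_of_list_inject[OF w w, of i j] by (simp add: nth del: upt_Suc)
      qed
      moreover have "set (?F \<omega>) \<subseteq> cube N" using w by (auto simp: bits_of_list_in_cube)
      moreover have "successively (\<lambda>a b. b - a \<in> flips N) (?F \<omega>)"
        unfolding successively_conv_nth
      proof (intro allI impI)
        fix i assume "Suc i < length (?F \<omega>)"
        then have i: "Suc i \<le> n" by simp
        then show "?F \<omega> ! Suc i - ?F \<omega> ! i \<in> flips N"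
          using st[of "Suc i"] w[of i] w[of "Suc i"] nth[of i] nth[of "Suc i"] adjacent_iff by simp
      qed
      moreover have "hd (?F \<omega>) = 0" using z zero by (simp add: hd_map del: upt_Suc)
      ultimately show "?F \<omega> \<in> paths_of_length n 0"
        by (simp add: paths_of_length_def saw_def)
    qed
    show "?G \<in> paths_of_length n 0 \<rightarrow> ?A"
    proof
      fix p assume p: "p \<in> paths_of_length n 0"
      have c: "p ! i \<in> cube N" if "i \<le> n" for i
        using p that nth_mem[of i p] by (auto simp: paths_of_length_def saw_def)
      have h: "map (p ! i) [0..<N] \<in> hypercube N" for i by (simp add: hypercube_def)
      have b: "bits_of_list (map (p ! i) [0..<N]) = p ! i" if "i \<le> n" for i
        using c[OF that] by (rule bits_of_list_map)
      have "map (p ! i) [0..<N] \<noteq> map (p ! j) [0..<N]" if "i \<le> n" "j \<le> n" "i \<noteq> j" for i j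
      proof
        assume "map (p ! i) [0..<N] = map (p ! j) [0..<N]"
        then have "p ! i = p ! j" using b[OF that(1)] b[OF that(2)] by metis
        then show False using p that by (auto simp: paths_of_length_def saw_def nth_eq_iff_index_eq)
      qed
      moreover have "hc_weight (hc_diff (map (p ! i) [0..<N]) (map (p ! (i - 1)) [0..<N])) = 1"
        if "1 \<le> i" "i \<le> n" for i
        unfolding adjacent_iff[OF h h]
        using p that b[of i] b[of "i - 1"]
        by (cases i) (auto simp: paths_of_length_def saw_def successively_conv_nth)
      moreover have "map (p ! 0) [0..<N] = hc_zero N"
        using p by (cases p) (auto simp: paths_of_length_def hc_zero_def intro!: nth_equalityI)
      ultimately show "?G p \<in> ?A"
        using h by (auto simp: self_avoiding_walks_def)
    qed
    show "?G (?F \<omega>) = \<omega>" if "\<omega> \<in> ?A" for \<omega>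
    proof
      fix i
      have m: "\<omega> \<in> {0..n} \<rightarrow>\<^sub>E hypercube N" using that by (auto simp: self_avoiding_walks_def)
      show "?G (?F \<omega>) i = \<omega> i"
      proof (cases "i \<le> n")
        case True
        then have "length (\<omega> i) = N" using m by (auto simp: hypercube_def PiE_def Pi_def)
        then show ?thesis using True by (simp add: map_bits_of_list del: upt_Suc)
      next
        case False
        then show ?thesis using m by (simp add: PiE_def extensional_def)
      qed
    qed
    show "?F (?G p) = p" if p: "p \<in> paths_of_length n 0" for p
    proof (rule nth_equalityI)
      show "length (?F (?G p)) = length p" using p by (simp add: paths_of_length_def)
      fix i assume "i < length (?F (?G p))"
      then have i: "i \<le> n" by simp
      then have "p ! i \<in> cube N"
        using p nth_mem[of i p] by (auto simp: paths_of_length_def saw_def)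
      then show "?F (?G p) ! i = p ! i" using i by (simp add: bits_of_list_map del: upt_Suc)
    qed
  qed
  then show ?thesis unfolding saw_count_def by (rule bij_betw_same_card)
qed

section \<open>Walsh transform\<close>

definition bit_sign :: "bit \<Rightarrow> real" where
  "bit_sign b = (if b = 0 then 1 else - 1)"

text \<open>The characters of \<open>Z_2^N\<close>, indexed by subsets of the coordinates.\<close>

definition walsh :: "nat set \<Rightarrow> (nat \<Rightarrow> bit) \<Rightarrow> real" where
  "walsh A x = (\<Prod>i\<in>A. bit_sign (x i))"

definition walsh_transform :: "nat \<Rightarrow> ((nat \<Rightarrow> bit) \<Rightarrow> real) \<Rightarrow> nat set \<Rightarrow> real" where
  "walsh_transform N f A = (\<Sum>x\<in>cube N. walsh A x * f x)"

lemma bit_sign_add: "bit_sign (a + b) = bit_sign a * bit_sign b"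
  by (cases a; cases b) (auto simp: bit_sign_def)

lemma walsh_add: "walsh A (x + y) = walsh A x * walsh A y"
  unfolding walsh_def plus_fun_apply bit_sign_add by (rule prod.distrib)

lemma walsh_diff: "walsh A (x - y) = walsh A x * walsh A y"
  using walsh_add[of A x "- y"] unfolding diff_conv_add_uminus uminus_bit_fun .

lemma walsh_empty [simp]: "walsh {} x = 1"
  by (simp add: walsh_def)

lemma walsh_0 [simp]: "walsh A 0 = 1"
  by (simp add: walsh_def bit_sign_def)

text \<open>The sum over subsets factorizes over coordinates, and a coordinate equal to 1 gives a
  factor 0.\<close>

lemma sum_walsh:
  assumes "x \<in> cube N"
  shows "(\<Sum>A\<in>Pow {..<N}. walsh A x) = (if x = 0 then 2 ^ N else 0)"
proof -
  have "(\<Sum>A\<in>Pow {..<N}. walsh A x) = (\<Prod>i<N. bit_sign (x i) + 1)"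
    by (subst prod_add) (auto simp: walsh_def)
  also have "\<dots> = (if x = 0 then 2 ^ N else 0)"
  proof (cases "x = 0")
    case True
    then show ?thesis by (simp add: bit_sign_def)
  next
    case False
    then obtain i where "x i \<noteq> 0" by (auto simp: fun_eq_iff)
    then have "i < N" "bit_sign (x i) + 1 = 0"
      using assms by (auto simp: cube_def bit_sign_def not_le[symmetric])
    then show ?thesis using False by (auto intro!: prod_zero)
  qed
  finally show ?thesis .
qed

text \<open>Expand the square and apply the orthogonality in \<open>sum_walsh\<close>;
  \<open>2 ^ N\<close> appears because the transform is not normalized.\<close>

lemma parseval:
  "(\<Sum>A\<in>Pow {..<N}. (walsh_transform N f A)\<^sup>2) = 2 ^ N * (\<Sum>x\<in>cube N. (f x)\<^sup>2)"
proof -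
  have sum0: "x - y \<in> cube N" if "x \<in> cube N" "y \<in> cube N" for x y
    using that by (auto simp: cube_def)
  have "(\<Sum>A\<in>Pow {..<N}. (walsh_transform N f A)\<^sup>2) =
      (\<Sum>A\<in>Pow {..<N}. \<Sum>x\<in>cube N. \<Sum>y\<in>cube N. walsh A (x - y) * (f x * f y))"
    unfolding walsh_transform_def power2_eq_square sum_product
    by (simp add: walsh_diff mult_ac)
  also have "\<dots> = (\<Sum>x\<in>cube N. \<Sum>y\<in>cube N. \<Sum>A\<in>Pow {..<N}. walsh A (x - y) * (f x * f y))"
    by (subst sum.swap) (intro sum.cong refl sum.swap)
  also have "\<dots> = (\<Sum>x\<in>cube N. \<Sum>y\<in>cube N. if x = y then 2 ^ N * (f x)\<^sup>2 else 0)"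
    by (intro sum.cong refl)
      (auto simp: sum_distrib_right[symmetric] sum_walsh sum0 power2_eq_square)
  also have "\<dots> = 2 ^ N * (\<Sum>x\<in>cube N. (f x)\<^sup>2)"
    by (simp add: finite_cube sum_distrib_left)
  finally show ?thesis .
qed

lemma walsh_flip: "finite A \<Longrightarrow> walsh A (flip i) = (if i \<in> A then - 1 else 1)"
proof -
  assume A: "finite A"
  have "walsh A (flip i) = (\<Prod>j\<in>A. if j = i then - 1 else 1)"
    by (auto simp: walsh_def flip_def bit_sign_def intro!: prod.cong)
  then show ?thesis using A by simp
qed

text \<open>Translation by \<open>flip i\<close> multiplies the transform by -1 if
  \<open>i \<in> A\<close> and by 1 otherwise, whence the eigenvalue.\<close>

lemma walsh_transform_neighbours:
  assumes A: "A \<subseteq> {..<N}"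
  shows "walsh_transform N (\<lambda>x. \<Sum>e\<in>flips N. f (x - e)) A =
    (real N - 2 * real (card A)) * walsh_transform N f A"
proof -
  interpret cayley "cube N" "flips N" by (rule cayley_cube)
  have shift: "(\<Sum>x\<in>cube N. walsh A x * f (x - e)) = walsh A e * walsh_transform N f A"
    if "e \<in> flips N" for e
  proof -
    have "e \<in> cube N" using that S_Q by auto
    have "(\<Sum>x\<in>cube N. walsh A x * f (x - e)) = (\<Sum>x\<in>cube N. walsh A (x - e + e) * f (x - e))"
      by simp
    also have "\<dots> = (\<Sum>x\<in>cube N. walsh A (x + e) * f x)"
      using sum_shift_Q[OF \<open>e \<in> cube N\<close>, of "\<lambda>x. walsh A (x + e) * f x"] .
    also have "\<dots> = walsh A e * walsh_transform N f A"
      by (simp add: walsh_add walsh_transform_def sum_distrib_left mult_ac)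
    finally show ?thesis .
  qed
  have fA: "finite A" using A finite_subset by blast
  have "walsh_transform N (\<lambda>x. \<Sum>e\<in>flips N. f (x - e)) A
      = (\<Sum>e\<in>flips N. \<Sum>x\<in>cube N. walsh A x * f (x - e))"
    unfolding walsh_transform_def sum_distrib_left by (rule sum.swap)
  also have "\<dots> = (\<Sum>i<N. walsh A (flip i)) * walsh_transform N f A"
    by (simp add: shift sum_distrib_right sum_flips[symmetric])
  also have "(\<Sum>i<N. walsh A (flip i)) = (\<Sum>i<N. 1 - 2 * (if i \<in> A then 1 else 0))"
    using fA by (intro sum.cong) (auto simp: walsh_flip)
  also have "\<dots> = real N - 2 * real (card A)"
    using A by (simp add: sum_subtractf sum_distrib_left[symmetric] sum.If_cases Int_absorb1)
  finally show ?thesis .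
qed

section \<open>Sums over Walsh modes and over pairs of steps\<close>

lemma sum_binomial_square:
  "(\<Sum>i\<le>M. real (M choose i) * (c - 2 * real i)\<^sup>2) = 2 ^ M * ((c - real M)\<^sup>2 + real M)"
\<comment> \<open>Up to \<open>2 ^ M\<close>, this is the second moment of \<open>c - 2 X\<close>
  for a binomial X with mean M/2 and variance M/4. By Pascal's rule the step uses the hypothesis at
  \<open>c\<close> and at \<open>c - 2\<close>.\<close>
proof (induction M arbitrary: c)
  case 0
  then show ?case by simp
next
  case (Suc M)
  let ?f = "\<lambda>i. (c - 2 * real i)\<^sup>2"
  have "(\<Sum>i\<le>Suc M. real (Suc M choose i) * ?f i)
      = ?f 0 + (\<Sum>i\<le>M. real (M choose Suc i) * ?f (Suc i)) + (\<Sum>i\<le>M. real (M choose i) * ?f (Suc i))"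
    by (subst sum.atMost_Suc_shift) (simp add: algebra_simps sum.distrib)
  also have "?f 0 + (\<Sum>i\<le>M. real (M choose Suc i) * ?f (Suc i)) = (\<Sum>i\<le>Suc M. real (M choose i) * ?f i)"
    by (subst sum.atMost_Suc_shift) simp
  also have "\<dots> = (\<Sum>i\<le>M. real (M choose i) * ?f i)" by simp
  also have "(\<Sum>i\<le>M. real (M choose i) * ?f (Suc i)) = (\<Sum>i\<le>M. real (M choose i) * (c - 2 - 2 * real i)\<^sup>2)"
    by (intro sum.cong refl) (simp add: algebra_simps)
  finally show ?case
    unfolding Suc.IH by (simp add: power2_eq_square algebra_simps)
qed

lemma sum_Pow_card:
  fixes f :: "nat \<Rightarrow> real"
  shows "(\<Sum>A\<in>Pow {..<N}. f (card A)) = (\<Sum>j\<le>N. real (N choose j) * f j)"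
proof -
  have "(\<Sum>A\<in>Pow {..<N}. f (card A)) = (\<Sum>j\<le>N. \<Sum>A\<in>{A \<in> Pow {..<N}. card A = j}. f (card A))"
    by (rule sum.group[symmetric]) (use card_mono[of "{..<N}"] in auto)
  also have "\<dots> = (\<Sum>j\<le>N. real (N choose j) * f j)"
    using n_subsets[of "{..<N}"] by (intro sum.cong) (auto simp: Pow_def)
  finally show ?thesis .
qed

text \<open>The inverse square is traded for \<open>1 / ((j + 1) (j + 2))\<close>, which the binomial coefficient absorbs.\<close>

lemma sum_inverse_square_weight_le:
  assumes "N \<ge> 1"
  shows "(\<Sum>A\<in>Pow {..<N} - {{}}. (real N - 2 * real (card A))\<^sup>2 / (real (card A))\<^sup>2) \<le> 48 * 2 ^ N / real N"
proof -
  let ?g = "\<lambda>j. if j = 0 then 0 else (real N - 2 * real j)\<^sup>2 / (real j)\<^sup>2"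
  have "(\<Sum>A\<in>Pow {..<N} - {{}}. (real N - 2 * real (card A))\<^sup>2 / (real (card A))\<^sup>2)
      = (\<Sum>A\<in>Pow {..<N}. ?g (card A))"
  proof (intro sum.mono_neutral_cong_left)
    fix A assume "A \<in> Pow {..<N} - {{}}"
    then have "finite A" "A \<noteq> {}" using finite_subset[of A "{..<N}"] by auto
    then show "(real N - 2 * real (card A))\<^sup>2 / (real (card A))\<^sup>2 = ?g (card A)" by simp
  qed auto
  also have "\<dots> = (\<Sum>j\<le>N. real (N choose j) * ?g j)" by (rule sum_Pow_card)
  also have "\<dots> \<le> (\<Sum>j\<le>N. 6 / (real (N + 1) * real (N + 2)) *
      (real (N + 2 choose (j + 2)) * (real N + 4 - 2 * real (j + 2))\<^sup>2))"
  proof (rule sum_mono)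
    fix j assume "j \<in> {..N}"
    have "Suc j * (Suc (Suc j) * (Suc (Suc N) choose Suc (Suc j))) = Suc (Suc N) * (Suc N * (N choose j))"
      by (metis Suc_times_binomial mult.left_commute)
    then have "real (Suc j) * (real (Suc (Suc j)) * real (Suc (Suc N) choose Suc (Suc j)))
        = real (Suc (Suc N)) * (real (Suc N) * real (N choose j))"
      unfolding of_nat_mult[symmetric] by (rule arg_cong)
    then have "real (N choose j) * (real (N + 1) * real (N + 2)) =
        real (j + 1) * real (j + 2) * real (N + 2 choose (j + 2))"
      by (simp only: add_2_eq_Suc' Suc_eq_plus1[symmetric] mult_ac)
    then have b: "real (N choose j) = real (j + 1) * real (j + 2) * real (N + 2 choose (j + 2)) / (real (N + 1) * real (N + 2))"
      by (subst eq_divide_eq) (simp del: of_nat_add)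
    \<comment> \<open>For \<open>j \<ge> 1\<close>,
      \<open>(j + 1) * (j + 2) \<le> 6 * j\<^sup>2\<close>, with equality at 1.\<close>
    have "?g j \<le> 6 * (real N - 2 * real j)\<^sup>2 / (real (j + 1) * real (j + 2))"
    proof (cases "j = 0")
      case False
      have "j * 1 \<le> j * j" "1 \<le> j * j" using False by (auto intro!: mult_le_mono)
      then have "real (j * 1) \<le> real (j * j)" "1 \<le> real (j * j)" by linarith+
      then have "real (j + 1) * real (j + 2) \<le> 6 * (real j)\<^sup>2"
        by (simp add: power2_eq_square algebra_simps)
      then have "(real N - 2 * real j)\<^sup>2 * (real (j + 1) * real (j + 2)) \<le> (real N - 2 * real j)\<^sup>2 * (6 * (real j)\<^sup>2)"
        by (intro mult_left_mono) auto
      then show ?thesis using False by (simp add: divide_simps mult_ac)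
    qed simp
    then have "real (N choose j) * ?g j \<le> real (N choose j) * (6 * (real N - 2 * real j)\<^sup>2 / (real (j + 1) * real (j + 2)))"
      by (intro mult_left_mono) auto
    also have "\<dots> = 6 / (real (N + 1) * real (N + 2)) *
      (real (N + 2 choose (j + 2)) * (real N + 4 - 2 * real (j + 2))\<^sup>2)"
      unfolding b by (simp add: divide_simps) 
    finally show "real (N choose j) * ?g j \<le> 6 / (real (N + 1) * real (N + 2)) *
      (real (N + 2 choose (j + 2)) * (real N + 4 - 2 * real (j + 2))\<^sup>2)" .
  qed
  also have "\<dots> = 6 / (real (N + 1) * real (N + 2)) *
      (\<Sum>j\<le>N. real (N + 2 choose (j + 2)) * (real N + 4 - 2 * real (j + 2))\<^sup>2)"
    by (simp add: sum_distrib_left)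
  also have "\<dots> \<le> 6 / (real (N + 1) * real (N + 2)) *
      (\<Sum>i\<le>N + 2. real (N + 2 choose i) * (real N + 4 - 2 * real i)\<^sup>2)"
  proof (rule mult_left_mono)
    have "(\<Sum>j\<le>N. real (N + 2 choose (j + 2)) * (real N + 4 - 2 * real (j + 2))\<^sup>2)
      = (\<Sum>i\<in>(\<lambda>j. j + 2) ` {..N}. real (N + 2 choose i) * (real N + 4 - 2 * real i)\<^sup>2)"
      by (subst sum.reindex) (auto simp: inj_on_def)
    also have "\<dots> \<le> (\<Sum>i\<le>N + 2. real (N + 2 choose i) * (real N + 4 - 2 * real i)\<^sup>2)"
      by (intro sum_mono2) auto
    finally show "(\<Sum>j\<le>N. real (N + 2 choose (j + 2)) * (real N + 4 - 2 * real (j + 2))\<^sup>2)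
      \<le> (\<Sum>i\<le>N + 2. real (N + 2 choose i) * (real N + 4 - 2 * real i)\<^sup>2)" .
  qed simp
  \<comment> \<open>\<open>sum_binomial_square\<close> with \<open>M = N + 2\<close> and
    \<open>c = N + 4\<close>: the square is 4, and the total is
    \<open>4 * 2 ^ N * (N + 6)\<close>.\<close>
  also have "\<dots> = 24 * 2 ^ N * ((real N + 6) / (real (N + 1) * real (N + 2)))"
    unfolding sum_binomial_square by (simp add: power_add)
  also have "\<dots> \<le> 24 * 2 ^ N * (2 / real N)"
  proof (rule mult_left_mono)
    show "(real N + 6) / (real (N + 1) * real (N + 2)) \<le> 2 / real N"
      using assms by (simp add: divide_simps) (simp add: algebra_simps)
  qed simp
  finally show ?thesis by simp
qed

text \<open>For \<open>i < j\<close> the vertices \<open>flip i + flip j\<close> are distinct, so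
  the squares over all off-diagonal pairs sum to at most twice the l2 sum. Cauchy-Schwarz over at
  most \<open>N * N\<close> pairs gives the factor sqrt 2, rounded up to 2; the diagonal, all at 0,
  adds 1.\<close>

lemma sum_flip_pairs_le:
  fixes F :: "(nat \<Rightarrow> bit) \<Rightarrow> real"
  shows "(\<Sum>i<N. \<Sum>j<N. F (flip i + flip j)) \<le> 3 * real N * sqrt (\<Sum>y\<in>cube N. (F y)\<^sup>2)"
proof -
  define b where "b = (\<Sum>y\<in>cube N. (F y)\<^sup>2)"
  let ?u = "\<lambda>(i, j). flip i + flip j"
  let ?L = "{(i, j). i < j \<and> j < N}" and ?R = "{(i, j). j < i \<and> i < N}"
  have fin: "finite ?L" "finite ?R"
    by (rule finite_subset[of _ "{..<N} \<times> {..<N}"]; auto)+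
  have b0: "b \<ge> 0" unfolding b_def by (intro sum_nonneg) auto
  have supp: "{m. (flip i + flip j) m = 1} = {i, j}" if "i \<noteq> j" for i j
    using that by (auto simp: flip_def)
  have inj: "inj_on ?u ?L"
  proof (rule inj_onI, clarify)
    fix i j k l :: nat assume "i < j" "k < l" "flip i + flip j = flip k + flip l"
    then show "i = k \<and> j = l"
      using supp[of i j] supp[of k l] by (auto simp: doubleton_eq_iff)
  qed
  have cube: "?u ` ?L \<subseteq> cube N" by (auto simp: cube_def flip_def)
  have L: "(\<Sum>q\<in>?L. (F (?u q))\<^sup>2) \<le> b"
  proof -
    have "(\<Sum>q\<in>?L. (F (?u q))\<^sup>2) = (\<Sum>y\<in>?u ` ?L. (F y)\<^sup>2)"
      by (subst sum.reindex[OF inj]) simp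
    also have "\<dots> \<le> b" unfolding b_def using cube finite_cube by (intro sum_mono2) auto
    finally show ?thesis .
  qed
  have R: "(\<Sum>q\<in>?R. (F (?u q))\<^sup>2) = (\<Sum>q\<in>?L. (F (?u q))\<^sup>2)"
    by (rule sum.reindex_bij_witness[where i = prod.swap and j = prod.swap]) (auto simp: add.commute)
  have off: "(\<Sum>q\<in>?L \<union> ?R. F (?u q)) \<le> 2 * (real N * sqrt b)"
  proof -
    have "(\<Sum>q\<in>?L \<union> ?R. 1 * F (?u q))\<^sup>2 \<le> (\<Sum>q\<in>?L \<union> ?R. 1\<^sup>2) * (\<Sum>q\<in>?L \<union> ?R. (F (?u q))\<^sup>2)"
      by (rule Cauchy_Schwarz_ineq_sum)
    also have "\<dots> \<le> (real N * real N) * (2 * b)"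
    proof (rule mult_mono)
      have "card (?L \<union> ?R) \<le> card ({..<N} \<times> {..<N})" by (rule card_mono) auto
      then have "card (?L \<union> ?R) \<le> N * N" by simp
      then have "real (card (?L \<union> ?R)) \<le> real N * real N" unfolding of_nat_mult[symmetric] by linarith
      then show "(\<Sum>q\<in>?L \<union> ?R. 1\<^sup>2) \<le> real N * real N" by simp
      have "(\<Sum>q\<in>?L \<union> ?R. (F (?u q))\<^sup>2) = (\<Sum>q\<in>?L. (F (?u q))\<^sup>2) + (\<Sum>q\<in>?R. (F (?u q))\<^sup>2)"
        using fin by (intro sum.union_disjoint) auto
      then show "(\<Sum>q\<in>?L \<union> ?R. (F (?u q))\<^sup>2) \<le> 2 * b" using L R by simp
    qed (auto intro: sum_nonneg)
    also have "\<dots> \<le> (2 * (real N * sqrt b))\<^sup>2"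
      using b0 by (simp add: power_mult_distrib power2_eq_square mult_ac)
    finally have "(\<Sum>q\<in>?L \<union> ?R. F (?u q))\<^sup>2 \<le> (2 * (real N * sqrt b))\<^sup>2" by simp
    then show ?thesis by (rule power2_le_imp_le) (use b0 in simp)
  qed
  have "F 0 \<le> sqrt b"
  proof (rule power2_le_imp_le)
    have "0 \<in> cube N" by (simp add: cube_def)
    then show "(F 0)\<^sup>2 \<le> (sqrt b)\<^sup>2"
      using b0 finite_cube member_le_sum[of 0 "cube N" "\<lambda>y. (F y)\<^sup>2"] by (simp add: b_def)
  qed (use b0 in simp)
  then have diag: "(\<Sum>i<N. F (flip i + flip i)) \<le> real N * sqrt b"
  proof -
    have "flip i + flip i = 0" for i by (rule ext) (simp add: flip_def)
    then show ?thesis using \<open>F 0 \<le> sqrt b\<close> by (simp add: mult_left_mono)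
  qed
  have "(\<Sum>i<N. \<Sum>j<N. F (flip i + flip j)) = (\<Sum>q\<in>{..<N} \<times> {..<N}. F (?u q))"
    by (simp add: sum.cartesian_product case_prod_unfold)
  also have "{..<N} \<times> {..<N} = (?L \<union> ?R) \<union> (\<lambda>i. (i, i)) ` {..<N}" by auto
  also have "(\<Sum>q\<in>\<dots>. F (?u q)) = (\<Sum>q\<in>?L \<union> ?R. F (?u q)) + (\<Sum>q\<in>(\<lambda>i. (i, i)) ` {..<N}. F (?u q))"
    using fin by (intro sum.union_disjoint) auto
  also have "(\<Sum>q\<in>(\<lambda>i. (i, i)) ` {..<N}. F (?u q)) = (\<Sum>i<N. F (flip i + flip i))"
    by (subst sum.reindex) (auto simp: inj_on_def)
  also have "(\<Sum>q\<in>?L \<union> ?R. F (?u q)) + (\<Sum>i<N. F (flip i + flip i)) \<le>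
      2 * (real N * sqrt b) + real N * sqrt b"
    by (rule add_mono[OF off diag])
  also have "\<dots> = 3 * real N * sqrt b" by simp
  finally show ?thesis unfolding b_def .
qed

section \<open>The bootstrap\<close>

locale cube_walks =
  fixes N :: nat
  assumes N_pos: "N \<ge> 1"

sublocale cube_walks \<subseteq> cayley "cube N" "flips N"
  by (rule cayley_cube)

context cube_walks
begin

text \<open>The function off 0 has squared l2 norm \<open>bubble z\<close>, also after reflection at
  \<open>x\<close>, so the pair sum in \<open>two_point_sup_le\<close> is at most
  \<open>3 * N\<close>. As \<open>z * N \<le> 2\<close>, the constant is
  \<open>2 + 4 * 2\<^sup>2 = 18\<close>.\<close>

lemma two_point_le_inverse_dim:
  assumes z: "0 \<le> z" "z * real N \<le> 2" and b: "bubble z \<le> 1" and x: "x \<in> cube N" "x \<noteq> 0"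
  shows "two_point z x \<le> 18 / real N"
proof -
  let ?h = "\<lambda>x. if x = 0 then 0 else two_point z x"
  have "(\<Sum>y\<in>cube N. (?h (x - y))\<^sup>2) = (\<Sum>y\<in>cube N. (?h y)\<^sup>2)"
    by (rule sum_reflect_Q[OF x(1)])
  also have "\<dots> = bubble z"
    unfolding bubble_def using finite_Q by (intro sum.mono_neutral_cong_right) auto
  finally have hb: "(\<Sum>y\<in>cube N. (?h (x - y))\<^sup>2) = bubble z" .
  have "sqrt (bubble z) \<le> 1" using b by simp
  then have "3 * real N * sqrt (bubble z) \<le> 3 * real N" by (simp add: mult_left_le)
  moreover have "(\<Sum>e\<in>flips N. \<Sum>f\<in>flips N. ?h (x - e - f)) \<le> 3 * real N * sqrt (bubble z)"
    using sum_flip_pairs_le[of "\<lambda>y. ?h (x - y)" N] unfolding hb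
    by (simp only: sum_flips diff_diff_add)
  ultimately have "(\<Sum>e\<in>flips N. \<Sum>f\<in>flips N. ?h (x - e - f)) \<le> 3 * real N" by linarith
  then have "two_point z x \<le> z + z\<^sup>2 * real N + z\<^sup>2 * (3 * real N)"
    by (intro order_trans[OF two_point_sup_le[OF z(1) x]]) (simp only: card_flips add_left_mono mult_left_mono zero_le_power2)
  then have "two_point z x * real N \<le> (z + z\<^sup>2 * real N + z\<^sup>2 * (3 * real N)) * real N"
    by (rule mult_right_mono) simp
  also have "\<dots> = z * real N + 4 * (z * real N)\<^sup>2" by (simp add: power2_eq_square algebra_simps)
  also have "\<dots> \<le> 2 + 4 * 2\<^sup>2" using z by (intro add_mono mult_left_mono power_mono) auto
  finally show ?thesis using N_pos by (simp add: field_simps)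
qed

text \<open>The \<open>p\<close> of the expansion. The immediate return over a single edge counts as
  a closed walk here.\<close>

definition polygon_weight :: "real \<Rightarrow> real" where
  "polygon_weight z = z * (\<Sum>e\<in>flips N. two_point z e)"

lemma polygon_weight_nonneg: "z \<ge> 0 \<Longrightarrow> polygon_weight z \<ge> 0"
  unfolding polygon_weight_def by (intro mult_nonneg_nonneg sum_nonneg two_point_nonneg)

section \<open>The expansion in Walsh variables\<close>

lemma walsh_transform_two_point:
  assumes A: "A \<subseteq> {..<N}"
  shows "(1 + polygon_weight z - z * (real N - 2 * real (card A))) * walsh_transform N (two_point z) A =
    1 + walsh_transform N (remainder z) A"
proof -
  let ?g = "two_point z" and ?D = "\<lambda>x. \<Sum>e\<in>flips N. two_point z (x - e)"
  have "walsh_transform N ?g A = (\<Sum>x\<in>cube N. walsh A x *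
      ((if x = 0 then 1 else 0) + z * ?D x - polygon_weight z * ?g x + remainder z x))"
    unfolding walsh_transform_def polygon_weight_def
    by (intro sum.cong refl arg_cong2[where f = "(*)"] two_point_expansion)
  also have "\<dots> = (\<Sum>x\<in>cube N. walsh A x * (if x = 0 then 1 else 0)) + z * walsh_transform N ?D A
      - polygon_weight z * walsh_transform N ?g A + walsh_transform N (remainder z) A"
    unfolding walsh_transform_def
    by (simp add: algebra_simps sum.distrib sum_subtractf sum_distrib_left)
  also have "(\<Sum>x\<in>cube N. walsh A x * (if x = 0 then 1 else 0)) = (\<Sum>x\<in>cube N. if x = 0 then 1 else 0)"
    by (intro sum.cong) auto
  also have "\<dots> = 1" using finite_Q zero_Q by simp
  finally show ?thesis unfolding walsh_transform_neighbours[OF A] by (simp add: algebra_simps)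
qed

text \<open>In the constant mode the right side is at least 1 and the transform is the non-negative
  susceptibility, so the coefficient is positive.\<close>

lemma dim_times_z_less:
  assumes "z \<ge> 0"
  shows "z * real N < 1 + polygon_weight z"
proof -
  have "walsh_transform N (two_point z) {} \<ge> 0" "walsh_transform N (remainder z) {} \<ge> 0"
    using assms by (auto simp: walsh_transform_def intro!: sum_nonneg two_point_nonneg remainder_nonneg)
  moreover have "(1 + polygon_weight z - z * real N) * walsh_transform N (two_point z) {} =
      1 + walsh_transform N (remainder z) {}"
    using walsh_transform_two_point[of "{}" z] by simp
  ultimately have "(1 + polygon_weight z - z * real N) * walsh_transform N (two_point z) {} > 0" by linarith
  then show ?thesis
    using \<open>walsh_transform N (two_point z) {} \<ge> 0\<close> by (simp add: zero_less_mult_iff)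
qed

text \<open>Positivity of the case \<open>a = 0\<close>, which comes from \<open>\<chi> > 0\<close>, keeps the gap of the simple random walk.\<close>

lemma propagator_lower_bound:
  assumes z: "z \<ge> 0" and a: "1 \<le> a" "a \<le> real N"
  shows "a / (2 * real N) \<le> 1 + polygon_weight z - z * (real N - 2 * a)"
\<comment> \<open>For \<open>z * N \<ge> 1/2\<close> the gap term \<open>2 * z * a\<close> suffices;
  for smaller \<open>z\<close> the mass \<open>1 - z * N\<close> exceeds 1/2, which suffices as
  \<open>a \<le> N\<close>.\<close>
proof (cases "z * real N \<ge> 1 / 2")
  case True
  have "(z * real N) * a \<ge> 1 / 2 * a" using True a by (intro mult_right_mono) auto
  then have "a / (2 * real N) \<le> z * a" using N_pos by (simp add: field_simps)
  moreover have "0 \<le> z * a" using z a by simp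
  ultimately have "a / (2 * real N) \<le> 2 * (z * a)" by linarith
  then show ?thesis using dim_times_z_less[OF z] by (simp add: algebra_simps)
next
  case False
  have "a / (2 * real N) \<le> 1 / 2" using a N_pos by (simp add: field_simps)
  moreover have "0 \<le> z * a" using z a by simp
  ultimately have "a / (2 * real N) \<le> 1 - z * real N + 2 * (z * a)" using False by linarith
  then show ?thesis using polygon_weight_nonneg[OF z] by (simp add: algebra_simps)
qed

text \<open>The transform is \<open>(1 + r) / T\<close> with \<open>T \<ge> a / (2 * N)\<close>. The
  part from 1 keeps its dependence on \<open>a\<close>, to be summed over modes; in the part from
  \<open>r\<close> the quotient is bounded by \<open>N\<^sup>2\<close>, leaving a plain l2
  norm.\<close>

lemma walsh_neighbours_square_le:
  assumes z: "z \<ge> 0" and A: "A \<in> Pow {..<N} - {{}}"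
  shows "((real N - 2 * real (card A)) * walsh_transform N (two_point z) A)\<^sup>2
    \<le> 8 * (real N)\<^sup>2 * ((real N - 2 * real (card A))\<^sup>2 / (real (card A))\<^sup>2)
      + 8 * (real N)^4 * (walsh_transform N (remainder z) A)\<^sup>2"
proof -
  define a where "a = real (card A)"
  define d where "d = (real N - 2 * a)\<^sup>2"
  define r where "r = walsh_transform N (remainder z) A"
  define T where "T = 1 + polygon_weight z - z * (real N - 2 * a)"
  have fA: "finite A" using A finite_subset[of A "{..<N}"] by auto
  have "card A \<noteq> 0" "card A \<le> card {..<N}" using A fA card_mono[of "{..<N}" A] by auto
  then have a: "1 \<le> a" "a \<le> real N" by (auto simp: a_def)
  have Tl: "a / (2 * real N) \<le> T" unfolding T_def by (rule propagator_lower_bound[OF z a])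
  have N0: "real N > 0" using N_pos by simp
  then have T0: "T > 0" using Tl a by (smt (verit) divide_pos_pos)
  have "T * walsh_transform N (two_point z) A = 1 + r"
    using walsh_transform_two_point[of A z] A by (simp add: T_def a_def r_def)
  then have g: "walsh_transform N (two_point z) A = (1 + r) / T" using T0 by (simp add: field_simps)
  have d0: "d \<ge> 0" and dN: "d \<le> (real N)\<^sup>2"
    using a by (auto simp: d_def abs_le_square_iff[symmetric])
  have "1 / T \<le> 2 * real N / a" using Tl T0 a N0 by (simp add: field_simps)
  then have "(1 / T)\<^sup>2 \<le> (2 * real N / a)\<^sup>2" using T0 by (intro power_mono) auto
  then have iT: "1 / T\<^sup>2 \<le> 4 * (real N)\<^sup>2 / a\<^sup>2" by (simp add: power_divide power_mult_distrib)
  have sq: "(1 + r)\<^sup>2 \<le> 2 + 2 * r\<^sup>2" using sum_squares_bound[of 1 r] by (simp add: power2_sum)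
  have "((real N - 2 * a) * walsh_transform N (two_point z) A)\<^sup>2 = d * ((1 + r)\<^sup>2 * (1 / T\<^sup>2))"
    by (simp add: g d_def power_mult_distrib power_divide)
  also have "\<dots> \<le> d * ((2 + 2 * r\<^sup>2) * (4 * (real N)\<^sup>2 / a\<^sup>2))"
    using d0 sq iT by (intro mult_left_mono mult_mono) auto
  also have "\<dots> = 8 * (real N)\<^sup>2 * (d / a\<^sup>2) + 8 * (real N)\<^sup>2 * ((d / a\<^sup>2) * r\<^sup>2)"
    by (simp add: algebra_simps add_divide_distrib)
  also have "\<dots> \<le> 8 * (real N)\<^sup>2 * (d / a\<^sup>2) + 8 * (real N)\<^sup>2 * ((real N)\<^sup>2 * r\<^sup>2)"
  proof -
    have "1 \<le> a\<^sup>2" using a(1) by (rule one_le_power)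
    then have "d / a\<^sup>2 \<le> d / 1" using d0 by (intro divide_left_mono) auto
    then have "d / a\<^sup>2 \<le> (real N)\<^sup>2" using dN by simp
    then show ?thesis by (intro add_left_mono mult_left_mono mult_right_mono) auto
  qed
  also have "8 * (real N)\<^sup>2 * ((real N)\<^sup>2 * r\<^sup>2) = 8 * (real N)^4 * r\<^sup>2"
    by (simp add: power_numeral_reduce)
  finally show ?thesis by (simp add: a_def d_def r_def)
qed

text \<open>Parseval, with the constant mode kept apart because it has no gap; there the transform
  is the susceptibility. 384 is 8 times 48.\<close>

lemma sum_neighbours_square_le:
  assumes z: "z \<ge> 0"
  shows "2 ^ N * (\<Sum>x\<in>cube N. (\<Sum>e\<in>flips N. two_point z (x - e))\<^sup>2)
    \<le> (real N)\<^sup>2 * (\<Sum>x\<in>cube N. two_point z x)\<^sup>2 + 384 * real N * 2 ^ N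
      + 8 * (real N)^4 * (2 ^ N * (\<Sum>x\<in>cube N. (remainder z x)\<^sup>2))"
proof -
  let ?P = "Pow {..<N}" and ?G = "walsh_transform N (two_point z)" and ?R = "walsh_transform N (remainder z)"
  let ?q = "\<lambda>A. (real N - 2 * real (card A))\<^sup>2 / (real (card A))\<^sup>2"
  have "2 ^ N * (\<Sum>x\<in>cube N. (\<Sum>e\<in>flips N. two_point z (x - e))\<^sup>2)
      = (\<Sum>A\<in>?P. ((real N - 2 * real (card A)) * ?G A)\<^sup>2)"
    unfolding parseval[symmetric] by (intro sum.cong) (auto simp: walsh_transform_neighbours)
  also have "\<dots> = (real N * ?G {})\<^sup>2 + (\<Sum>A\<in>?P - {{}}. ((real N - 2 * real (card A)) * ?G A)\<^sup>2)"
    by (subst sum.remove[of _ "{}"]) auto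
  also have "(\<Sum>A\<in>?P - {{}}. ((real N - 2 * real (card A)) * ?G A)\<^sup>2)
      \<le> (\<Sum>A\<in>?P - {{}}. 8 * (real N)\<^sup>2 * ?q A + 8 * (real N)^4 * (?R A)\<^sup>2)"
    by (intro sum_mono walsh_neighbours_square_le z)
  also have "\<dots> = 8 * (real N)\<^sup>2 * (\<Sum>A\<in>?P - {{}}. ?q A) + 8 * (real N)^4 * (\<Sum>A\<in>?P - {{}}. (?R A)\<^sup>2)"
    unfolding sum.distrib sum_distrib_left[symmetric] ..
  also have "\<dots> \<le> 8 * (real N)\<^sup>2 * (48 * 2 ^ N / real N) + 8 * (real N)^4 * (\<Sum>A\<in>?P. (?R A)\<^sup>2)"
    by (intro add_mono mult_left_mono sum_inverse_square_weight_le[OF N_pos] sum_mono2) auto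
  also have "\<dots> = 384 * real N * 2 ^ N + 8 * (real N)^4 * (2 ^ N * (\<Sum>x\<in>cube N. (remainder z x)\<^sup>2))"
    unfolding parseval using N_pos by (simp add: power2_eq_square)
  finally have "2 ^ N * (\<Sum>x\<in>cube N. (\<Sum>e\<in>flips N. two_point z (x - e))\<^sup>2) \<le> (real N * ?G {})\<^sup>2
      + (384 * real N * 2 ^ N + 8 * (real N)^4 * (2 ^ N * (\<Sum>x\<in>cube N. (remainder z x)\<^sup>2)))"
    by (simp only: add_left_mono)
  moreover have "(real N * ?G {})\<^sup>2 = (real N)\<^sup>2 * (\<Sum>x\<in>cube N. two_point z x)\<^sup>2"
    by (simp add: walsh_transform_def power_mult_distrib)
  ultimately show ?thesis by (simp only: add.assoc)
qed

text \<open>\<open>\<nu>\<close> bounds the squared susceptibility per volume;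
  \<open>z\<^sup>2 \<le> 4 / N\<^sup>2\<close> multiplies the coefficients 1, 384 and 8 by
  4.\<close>

lemma bubble_le_l2:
  assumes z: "z \<ge> 0" "z * real N \<le> 2" and \<nu>: "(\<Sum>x\<in>cube N. two_point z x)\<^sup>2 \<le> \<nu> * 2 ^ N"
  shows "bubble z \<le> 4 * \<nu> + 1536 / real N + 32 * (real N)\<^sup>2 * (\<Sum>x\<in>cube N. (remainder z x)\<^sup>2)"
proof -
  define e where "e = (\<Sum>x\<in>cube N. (remainder z x)\<^sup>2)"
  define W where "W = (\<Sum>x\<in>cube N. (\<Sum>e\<in>flips N. two_point z (x - e))\<^sup>2)"
  have N0: "real N > 0" using N_pos by simp
  have "2 ^ N * W \<le> (real N)\<^sup>2 * (\<nu> * 2 ^ N) + 384 * real N * 2 ^ N + 8 * (real N)^4 * (2 ^ N * e)"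
    using sum_neighbours_square_le[OF z(1)] mult_left_mono[OF \<nu>, of "(real N)\<^sup>2"]
    by (simp add: W_def e_def)
  also have "\<dots> = 2 ^ N * ((real N)\<^sup>2 * \<nu> + 384 * real N + 8 * (real N)^4 * e)" by (simp add: algebra_simps)
  finally have W: "W \<le> (real N)\<^sup>2 * \<nu> + 384 * real N + 8 * (real N)^4 * e" by simp
  have W0: "W \<ge> 0" unfolding W_def by (intro sum_nonneg) auto
  have "z \<le> 2 / real N" using z N0 by (simp add: field_simps)
  then have "z\<^sup>2 \<le> (2 / real N)\<^sup>2" using z by (intro power_mono) auto
  then have "z\<^sup>2 * W \<le> (2 / real N)\<^sup>2 * ((real N)\<^sup>2 * \<nu> + 384 * real N + 8 * (real N)^4 * e)"
    using W W0 by (intro mult_mono) auto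
  also have "\<dots> = 4 * \<nu> + 1536 / real N + 32 * (real N)\<^sup>2 * e"
    using N0 by (simp add: field_simps power_numeral_reduce)
  finally show ?thesis using bubble_le[OF z(1)] by (simp add: W_def e_def)
qed

text \<open>The improvement comes from the remainder being quadratic: its l2 contribution is of
  order \<open>(bubble z + 1 / N)\<^sup>2\<close>, far below the assumed bound on
  \<open>bubble z\<close>.\<close>

lemma bootstrap_step:
  assumes N: "real N \<ge> 10^12" and z: "z \<ge> 0" "z * real N \<le> 2" and b: "bubble z \<le> 1 / 10^7"
    and \<chi>: "(\<Sum>x\<in>cube N. two_point z x)\<^sup>2 \<le> 1 / 10^12 * 2 ^ N"
  shows "z * real N \<le> 3 / 2" "bubble z \<le> 1 / (2 * 10^7)"
proof -
  have N0: "real N > 0" using N_pos by simp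
  have inv: "1 / real N \<le> 1 / 10^12" using N by (intro divide_left_mono) auto
  have b1: "bubble z \<le> 1" using b by simp
  have s: "two_point z x \<le> 18 / real N" if "x \<in> cube N" "x \<noteq> 0" for x
    by (rule two_point_le_inverse_dim[OF z b1 that])
  have "polygon_weight z \<le> z * (\<Sum>e\<in>flips N. 18 / real N)"
    unfolding polygon_weight_def using z S_Q zero_S by (intro mult_left_mono sum_mono s) auto
  also have "\<dots> = z * real N * (18 / real N)" by (simp add: card_flips)
  also have "\<dots> \<le> 2 * (18 / real N)" using z by (intro mult_right_mono) auto
  finally have "polygon_weight z \<le> 36 * (1 / real N)" by simp
  then show "z * real N \<le> 3 / 2" using dim_times_z_less[OF z(1)] inv by simp
  define \<theta> where "\<theta> = (\<Sum>y\<in>cube N. theta_kernel z y)"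
  have \<theta>0: "\<theta> \<ge> 0"
    unfolding \<theta>_def theta_kernel_def using z
    by (auto intro!: sum_nonneg mult_nonneg_nonneg two_point_nonneg)
  have "\<theta> \<le> z * real N * (18 / real N) * (18 / real N + bubble z)"
    using sum_theta_kernel_le[OF z(1) s] N0 unfolding \<theta>_def card_flips by simp
  also have "\<dots> \<le> 2 * (18 / real N) * (18 / real N + bubble z)"
    using z N0 bubble_nonneg by (intro mult_right_mono) auto
  finally have "real N * \<theta> \<le> real N * (2 * (18 / real N) * (18 / real N + bubble z))"
    by (intro mult_left_mono) auto
  also have "\<dots> = 36 * (18 * (1 / real N) + bubble z)" using N0 by simp
  also have "\<dots> \<le> 4 / 10^6" using b inv by simp
  finally have n\<theta>: "real N * \<theta> \<le> 4 / 10^6" .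
  have "(\<Sum>x\<in>cube N. (remainder z x)\<^sup>2) \<le> \<theta>\<^sup>2 * (1 + bubble z)"
    using remainder_l2_le[OF z(1)] by (simp add: \<theta>_def)
  also have "\<dots> \<le> \<theta>\<^sup>2 * 2" using b1 by (intro mult_left_mono) auto
  finally have "(real N)\<^sup>2 * (\<Sum>x\<in>cube N. (remainder z x)\<^sup>2) \<le> (real N)\<^sup>2 * (\<theta>\<^sup>2 * 2)"
    by (intro mult_left_mono) auto
  also have "\<dots> = 2 * (real N * \<theta>)\<^sup>2" by (simp add: power_mult_distrib)
  also have "\<dots> \<le> 2 * (4 / 10^6)\<^sup>2" using n\<theta> \<theta>0 by (intro mult_left_mono power_mono) auto
  finally have "(real N)\<^sup>2 * (\<Sum>x\<in>cube N. (remainder z x)\<^sup>2) \<le> 2 * (4 / 10^6)\<^sup>2" .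
  \<comment> \<open>The three terms are at most \<open>4 / 10^12\<close>,
    \<open>1536 / 10^12\<close> and \<open>1024 / 10^12\<close>, well below
    \<open>1 / (2 * 10^7)\<close>.\<close>
  then show "bubble z \<le> 1 / (2 * 10^7)"
    using bubble_le_l2[OF z \<chi>] inv by (simp add: power2_eq_square)
qed

section \<open>Continuity in \<open>z\<close> and the conclusion\<close>

lemma two_point_mono: "0 \<le> y \<Longrightarrow> y \<le> z \<Longrightarrow> two_point y x \<le> two_point z x"
  unfolding two_point_def green_def wt_def by (intro sum_mono power_mono) auto

lemma bubble_at_0: "bubble 0 = 0"
  using bubble_le[of 0] bubble_nonneg[of 0] by simp

lemma bubble_small:
  assumes N: "real N \<ge> 10^12" and z: "z \<ge> 0"
    and \<chi>: "(\<Sum>x\<in>cube N. two_point z x)\<^sup>2 \<le> 1 / 10^12 * 2 ^ N"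
  shows "bubble z \<le> 1 / 10^7"
proof (rule ccontr)
  assume neg: "\<not> bubble z \<le> 1 / 10^7"
  \<comment> \<open>\<open>\<phi> y \<le> 1\<close> encodes both bootstrap hypotheses. The step
    improves them to \<open>\<phi> y \<le> 3/4\<close>, so the value 1 is never attained; the
    susceptibility bound at \<open>z\<close> passes to smaller \<open>y\<close> by
    monotonicity.\<close>
  define \<phi> where "\<phi> y = max (y * (real N / 2)) (10^7 * bubble y)" for y
  have "continuous_on {0..z} \<phi>"
    unfolding \<phi>_def by (intro continuous_intros continuous_on_bubble)
  moreover have "\<phi> 0 \<le> 1" "1 \<le> \<phi> z" using neg by (auto simp: \<phi>_def bubble_at_0)
  ultimately obtain y where y: "0 \<le> y" "y \<le> z" "\<phi> y = 1"
    using IVT'[of \<phi> 0 1 z] z by auto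
  then have "y * real N \<le> 2" "bubble y \<le> 1 / 10^7"
    unfolding \<phi>_def by (auto simp: max_def split: if_splits)
  moreover have "(\<Sum>x\<in>cube N. two_point y x)\<^sup>2 \<le> (\<Sum>x\<in>cube N. two_point z x)\<^sup>2"
    using y by (intro power_mono sum_mono two_point_mono sum_nonneg two_point_nonneg)
  ultimately have "y * real N \<le> 3 / 2" "bubble y \<le> 1 / (2 * 10^7)"
    using bootstrap_step[OF N y(1)] \<chi> by auto
  then show False using y(3) by (auto simp: \<phi>_def max_def split: if_splits)
qed

lemma level_weight_eq_saw_count: "level_weight z n = real (saw_count N n) * z ^ n"
  by (simp add: level_weight_eq saw_count_eq_card_paths)

lemma susceptibility_eq: "susceptibility N z = (\<Sum>x\<in>cube N. two_point z x)"
proof -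
  have "{0..hc_volume N - 1} = {..<card (cube N)}"
    unfolding hc_volume_def card_cube using zero_less_power[of "2::nat" N]
    by (simp add: lessThan_Suc_atMost[symmetric] atLeast0AtMost)
  then show ?thesis
    by (simp add: susceptibility_def sum_two_point level_weight_eq_saw_count)
qed

end

theorem theorem1p1:
  shows "\<exists>lam0 K :: real. lam0 > 0 \<and> K > 0 \<and>
    (\<forall>n N :: nat. n \<ge> 1 \<longrightarrow> N \<ge> 1 \<longrightarrow> lam0 * sqrt (real (hc_volume N)) > 1 \<longrightarrow>
      real (saw_count N n) \<le> K * connective_constant N lam0 ^ n)"
proof -
  obtain N0 :: nat where N0: "real N0 \<ge> 10^12" using real_arch_simple by blast
  \<comment> \<open>With this value, \<open>lam * sqrt V > 1\<close> says exactly
    \<open>N > N0\<close>, and \<open>lam\<^sup>2 = 1 / 2 ^ N0\<close> is below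
    \<open>1 / 10^12\<close>.\<close>
  define lam where "lam = 1 / sqrt (2 ^ N0)"
  have lam0: "lam > 0" by (simp add: lam_def)
  have "real N0 \<le> 2 ^ N0" using of_nat_less_two_power[of N0, where 'a = real] by linarith
  then have "10^12 \<le> (2 ^ N0 :: real)" using N0 by (rule order_trans[rotated])
  then have "1 / 2 ^ N0 \<le> 1 / (10^12 :: real)" by (intro divide_left_mono) auto
  then have lam2: "lam\<^sup>2 \<le> 1 / 10^12" by (simp add: lam_def power_divide)
  have "real (saw_count N n) \<le> 2 * connective_constant N lam ^ n"
    if N: "N \<ge> 1" "lam * sqrt (real (hc_volume N)) > 1" for n N
  proof -
    interpret cube_walks N by unfold_locales (rule N)
    have "sqrt (2 ^ N0) < sqrt (2 ^ N)"
      using N(2) by (simp add: lam_def hc_volume_def field_simps)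
    then have "N0 < N" by simp
    then have NN: "real N \<ge> 10^12" using N0 by linarith
    define z where "z = critical_value N lam"
    have z: "z > 0" "susceptibility N z = lam * sqrt (real (hc_volume N))"
      using theI'[OF ex1_critical_value[OF N]] unfolding z_def critical_value_def by auto
    \<comment> \<open>At the critical value the squared susceptibility per volume is exactly
      \<open>lam\<^sup>2\<close>.\<close>
    have "(\<Sum>x\<in>cube N. two_point z x)\<^sup>2 = lam\<^sup>2 * 2 ^ N"
      using z(2) by (simp add: susceptibility_eq power_mult_distrib hc_volume_def)
    also have "\<dots> \<le> 1 / 10^12 * 2 ^ N" using lam2 by (intro mult_right_mono) auto
    finally have b: "bubble z \<le> 1 / 10^7" using z(1) by (intro bubble_small[OF NN]) auto
    then have "bubble z < 1" by simp
    then have "level_weight z n \<le> 1 / (1 - bubble z)" using z(1) by (intro level_weight_le) auto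
    also have "\<dots> \<le> 2" using b by (simp add: field_simps)
    finally have "real (saw_count N n) * z ^ n \<le> 2" by (simp add: level_weight_eq_saw_count)
    then show ?thesis
      using z(1) by (simp add: connective_constant_def z_def[symmetric] power_one_over field_simps)
  qed
  then show ?thesis using lam0 by (intro exI[of _ lam] exI[of _ 2]) auto
qed

end
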